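(* Let $R$ be a ring with $1\neq 0$, let $\Lambda$ be a set, and let $\Delta\subseteq\Lambda\times\Lambda$ satisfy axioms (A1) and (A2). Then the group $G(\Delta)$ is generated by all $x_{i,j}(a)$, with $(i,j)\in\Delta$ and $a\in R$, subject to the following defining relations (i.e. these generators and relations form a presentation of $G(\Delta)$), where $a,b\in R$: (1) for $(i,j),(j,k)\in\Delta$: $[x_{i,j}(a),x_{j,k}(b)]=x_{i,k}(ab)$ if $(i,k)\in\Delta$, and $[x_{i,j}(a),x_{j,k}(b)]=1$ otherwise; (2) for $(i,j),(k,\ell)\in\Delta$ with $j\neq k$ and $i\neq\ell$: $[x_{i,j}(a),x_{k,\ell}(b)]=1$; (3) for $(i,j)\in\Delta$: $x_{i,j}(a)x_{i,j}(b)=x_{i,j}(a+b)$.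
   Context: Rings are associative and unital, not necessarily commutative. For a subset $\Delta\subseteq\Lambda\times\Lambda$ the axioms are: (A1) $(i,i)\notin\Delta$ for all $i\in\Lambda$; (A2) whenever $(i,j),(j,k),(k,\ell),(i,\ell)\in\Delta$, one has $(i,k)\in\Delta\Leftrightarrow(j,\ell)\in\Delta$. $R\Delta$ is the free $R$-module with basis $\{e_{i,j} : (i,j)\in\Delta\}$, made into a (nonunital) ring by $(ae_{i,j})(be_{k,\ell})=ab\,e_{i,\ell}$ if $j=k$ and $(i,\ell)\in\Delta$, and $(ae_{i,j})(be_{k,\ell})=0$ otherwise. Adjoining $1$ gives the ring $R\cdot 1\oplus R\Delta$ (scalars from $R$ commute with the basis elements, i.e. $e_{i,j}\cdot r=r e_{i,j}$), and $G(\Delta)=\{1+x : x\in R\Delta\}$, a subgroup of its unit group. For $(i,j)\in\Delta$ and $a\in R$, $x_{i,j}(a)=1+ae_{i,j}\in G(\Delta)$. Commutators are $[u,v]=uvu^{-1}v^{-1}$. *)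

theory Defs
  imports "HOL-Algebra.Coset" "HOL-Algebra.Ring" "HOL-Library.Poly_Mapping"
begin

section \<open>Group presentations\<close>

text \<open>
  A letter \<open>(g, True)\<close> stands for the generator \<open>g\<close>, and \<open>(g, False)\<close> for its formal inverse.
\<close>

definition words :: "'g set \<Rightarrow> ('g \<times> bool) list set" where
  "words X = lists (X \<times> UNIV)"

inductive_set free_eq :: "'g set \<Rightarrow> (('g \<times> bool) list \<times> ('g \<times> bool) list) set"
  for X :: "'g set" where
  cancel: "\<lbrakk>u \<in> words X; v \<in> words X; g \<in> X\<rbrakk>
    \<Longrightarrow> (u @ [(g, b), (g, \<not> b)] @ v, u @ v) \<in> free_eq X"
| refl: "u \<in> words X \<Longrightarrow> (u, u) \<in> free_eq X"
| sym: "(u, v) \<in> free_eq X \<Longrightarrow> (v, u) \<in> free_eq X"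
| trans: "\<lbrakk>(u, v) \<in> free_eq X; (v, w) \<in> free_eq X\<rbrakk> \<Longrightarrow> (u, w) \<in> free_eq X"

definition free_group :: "'g set \<Rightarrow> ('g \<times> bool) list set monoid" where
  "free_group X =
    \<lparr>carrier = words X // free_eq X,
     mult = (\<lambda>A B. \<Union>u\<in>A. \<Union>v\<in>B. free_eq X `` {u @ v}),
     one = free_eq X `` {[]}\<rparr>"

definition free_gen :: "'g set \<Rightarrow> 'g \<Rightarrow> ('g \<times> bool) list set" where
  "free_gen X g = free_eq X `` {[(g, True)]}"

definition normal_closure :: "('a, 'b) monoid_scheme \<Rightarrow> 'a set \<Rightarrow> 'a set" where
  "normal_closure G S = \<Inter>{N. N \<lhd> G \<and> S \<subseteq> N}"

text \<open>A relation \<open>u = v\<close> is given as the pair \<open>(u, v)\<close> of elements of the free group.\<close>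

definition relator_closure ::
  "'g set \<Rightarrow> (('g \<times> bool) list set \<times> ('g \<times> bool) list set) set \<Rightarrow> ('g \<times> bool) list set set"
  where
  "relator_closure X Rel = normal_closure (free_group X)
     {u \<otimes>\<^bsub>free_group X\<^esub> inv\<^bsub>free_group X\<^esub> v | u v. (u, v) \<in> Rel}"

definition presented_group ::
  "'g set \<Rightarrow> (('g \<times> bool) list set \<times> ('g \<times> bool) list set) set
    \<Rightarrow> ('g \<times> bool) list set set monoid"
  where
  "presented_group X Rel = free_group X Mod relator_closure X Rel"

text \<open>
  \<open>X\<close> is a set of formal symbols, and \<open>f s\<close> is the element of \<open>G\<close> named by the symbol \<open>s\<close>.
\<close>

definition is_presentation ::
  "('a, 'b) monoid_scheme \<Rightarrow> 'g set \<Rightarrow> ('g \<Rightarrow> 'a)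
    \<Rightarrow> (('g \<times> bool) list set \<times> ('g \<times> bool) list set) set \<Rightarrow> bool"
  where
  "is_presentation G X f Rel \<longleftrightarrow>
     group G \<and> f \<in> X \<rightarrow> carrier G \<and>
     (\<exists>\<phi> \<in> iso (presented_group X Rel) G.
        \<forall>s\<in>X. \<phi> (relator_closure X Rel #>\<^bsub>free_group X\<^esub> free_gen X s) = f s)"

definition commutator :: "('a, 'b) monoid_scheme \<Rightarrow> 'a \<Rightarrow> 'a \<Rightarrow> 'a" where
  "commutator G u v = u \<otimes>\<^bsub>G\<^esub> v \<otimes>\<^bsub>G\<^esub> inv\<^bsub>G\<^esub> u \<otimes>\<^bsub>G\<^esub> inv\<^bsub>G\<^esub> v"

lemma free_eq_words: "(u, v) \<in> free_eq X \<Longrightarrow> u \<in> words X \<and> v \<in> words X"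
  by (induction rule: free_eq.induct) (auto simp: words_def)

lemma equiv_free_eq: "equiv (words X) (free_eq X)"
proof (rule equivI)
  show "free_eq X \<subseteq> words X \<times> words X" by (auto dest: free_eq_words)
  show "refl_on (words X) (free_eq X)" by (simp add: refl_on_def free_eq.refl)
  show "sym_on UNIV (free_eq X)" by (rule symI) (rule free_eq.sym)
  show "trans_on UNIV (free_eq X)" by (rule transI) (rule free_eq.trans)
qed

lemma words_append: "u \<in> words X \<Longrightarrow> v \<in> words X \<Longrightarrow> u @ v \<in> words X"
  by (auto simp: words_def)

lemma free_eq_append_right:
  "(u, u') \<in> free_eq X \<Longrightarrow> v \<in> words X \<Longrightarrow> (u @ v, u' @ v) \<in> free_eq X"
proof (induction rule: free_eq.induct)
  case (cancel u w g b)
  then show ?case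
    using free_eq.cancel[of u X "w @ v" g b] by (simp add: words_append)
next
  case (refl u)
  then show ?case by (simp add: free_eq.refl words_append)
next
  case (sym u w)
  then show ?case by (simp add: free_eq.sym)
next
  case (trans u w t)
  then show ?case by (blast intro: free_eq.trans)
qed

lemma free_eq_append_left:
  "(u, u') \<in> free_eq X \<Longrightarrow> v \<in> words X \<Longrightarrow> (v @ u, v @ u') \<in> free_eq X"
proof (induction rule: free_eq.induct)
  case (cancel u w g b)
  then show ?case
    using free_eq.cancel[of "v @ u" X w g b] by (simp add: words_append)
next
  case (refl u)
  then show ?case by (simp add: free_eq.refl words_append)
next
  case (sym u w)
  then show ?case by (simp add: free_eq.sym)
next
  case (trans u w t)
  then show ?case by (blast intro: free_eq.trans)
qed

lemma free_eq_append:
  "(u, u') \<in> free_eq X \<Longrightarrow> (v, v') \<in> free_eq X \<Longrightarrow> (u @ v, u' @ v') \<in> free_eq X"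
  by (rule free_eq.trans[OF free_eq_append_right free_eq_append_left])
    (simp_all add: free_eq_words)

lemma free_group_mult_class:
  assumes "u \<in> words X" "v \<in> words X"
  shows "(free_eq X `` {u}) \<otimes>\<^bsub>free_group X\<^esub> (free_eq X `` {v}) = free_eq X `` {u @ v}"
proof -
  have "congruent2 (free_eq X) (free_eq X) (\<lambda>u v. free_eq X `` {u @ v})"
    by (auto simp: congruent2_def intro!: equiv_class_eq[OF equiv_free_eq] free_eq_append)
  from UN_equiv_class2[OF equiv_free_eq equiv_free_eq this assms]
  show ?thesis by (simp add: free_group_def)
qed

definition word_inv :: "('g \<times> bool) list \<Rightarrow> ('g \<times> bool) list" where
  "word_inv w = rev (map (\<lambda>(g, b). (g, \<not> b)) w)"

lemma word_inv_words: "w \<in> words X \<Longrightarrow> word_inv w \<in> words X"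
  by (auto simp: words_def word_inv_def)

lemma free_eq_word_inv: "w \<in> words X \<Longrightarrow> (word_inv w @ w, []) \<in> free_eq X"
proof (induction w)
  case Nil
  then show ?case by (auto simp: word_inv_def words_def intro: free_eq.refl)
next
  case (Cons a w)
  obtain g b where a: "a = (g, b)" by (cases a)
  with Cons.prems have w: "w \<in> words X" "g \<in> X" by (auto simp: words_def)
  have "(word_inv w @ [(g, \<not> b), (g, \<not> \<not> b)] @ w, word_inv w @ w) \<in> free_eq X"
    using w by (intro free_eq.cancel word_inv_words)
  from free_eq.trans[OF this Cons.IH[OF w(1)]] show ?case
    by (simp add: a word_inv_def)
qed

lemma group_free_group: "group (free_group X)"
proof (rule groupI)
  note mult = free_group_mult_class
  have nil: "[] \<in> words X" by (simp add: words_def)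
  have car: "carrier (free_group X) = words X // free_eq X"
    and one: "\<one>\<^bsub>free_group X\<^esub> = free_eq X `` {[]}"
    by (simp_all add: free_group_def)
  show "\<one>\<^bsub>free_group X\<^esub> \<in> carrier (free_group X)"
    using nil by (auto simp: car one quotient_def)
  fix A assume "A \<in> carrier (free_group X)"
  then obtain u where u: "u \<in> words X" "A = free_eq X `` {u}"
    by (auto simp: car elim: quotientE)
  show "\<one>\<^bsub>free_group X\<^esub> \<otimes>\<^bsub>free_group X\<^esub> A = A"
    using u nil by (simp add: one mult)
  show "\<exists>B\<in>carrier (free_group X). B \<otimes>\<^bsub>free_group X\<^esub> A = \<one>\<^bsub>free_group X\<^esub>"
    using u word_inv_words[OF u(1)] equiv_class_eq[OF equiv_free_eq free_eq_word_inv[OF u(1)]]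
    by (intro bexI[of _ "free_eq X `` {word_inv u}"]) (auto simp: car one mult quotientI)
  fix B assume "B \<in> carrier (free_group X)"
  then obtain v where v: "v \<in> words X" "B = free_eq X `` {v}"
    by (auto simp: car elim: quotientE)
  show "A \<otimes>\<^bsub>free_group X\<^esub> B \<in> carrier (free_group X)"
    using u v by (simp add: car mult words_append quotientI)
  fix C assume "C \<in> carrier (free_group X)"
  then obtain w where w: "w \<in> words X" "C = free_eq X `` {w}"
    by (auto simp: car elim: quotientE)
  show "A \<otimes>\<^bsub>free_group X\<^esub> B \<otimes>\<^bsub>free_group X\<^esub> C = A \<otimes>\<^bsub>free_group X\<^esub> (B \<otimes>\<^bsub>free_group X\<^esub> C)"
    using u v w by (simp add: mult words_append)
qed

lemma (in group) normal_closure_normal: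
  assumes "S \<subseteq> carrier G"
  shows "normal_closure G S \<lhd> G"
proof (rule normal_invI)
  have "carrier G \<lhd> G" by (rule normal_invI[OF subgroup_self]) auto
  then have "{N. N \<lhd> G \<and> S \<subseteq> N} \<noteq> {}" using assms by blast
  then show "subgroup (normal_closure G S) G"
    unfolding normal_closure_def
    by (intro subgroups_Inter) (auto dest: normal_imp_subgroup)
  show "x \<otimes> h \<otimes> inv x \<in> normal_closure G S"
    if "x \<in> carrier G" "h \<in> normal_closure G S" for x h
    using that unfolding normal_closure_def by (blast intro: normal.inv_op_closed2)
qed

lemma presented_group_group:
  assumes "Rel \<subseteq> carrier (free_group X) \<times> carrier (free_group X)"
  shows "group (presented_group X Rel)"
proof -
  interpret F: group "free_group X" by (rule group_free_group)
  show ?thesis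
    unfolding presented_group_def relator_closure_def using assms
    by (intro normal.factorgroup_is_group F.normal_closure_normal) blast
qed

section \<open>The ring \<open>R\<Delta>\<close> and the group \<open>G(\<Delta>)\<close>\<close>

definition axiom_A1 :: "'i set \<Rightarrow> ('i \<times> 'i) set \<Rightarrow> bool" where
  "axiom_A1 \<Lambda> \<Delta> \<longleftrightarrow> (\<forall>i\<in>\<Lambda>. (i, i) \<notin> \<Delta>)"

definition axiom_A2 :: "('i \<times> 'i) set \<Rightarrow> bool" where
  "axiom_A2 \<Delta> \<longleftrightarrow> (\<forall>i j k l. (i, j) \<in> \<Delta> \<and> (j, k) \<in> \<Delta> \<and> (k, l) \<in> \<Delta> \<and> (i, l) \<in> \<Delta>
     \<longrightarrow> ((i, k) \<in> \<Delta> \<longleftrightarrow> (j, l) \<in> \<Delta>))"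

text \<open>
  The free module with basis \<open>\<Delta>\<close> consists of the finitely supported functions with support
  in \<open>\<Delta>\<close>, where \<^term>\<open>Poly_Mapping.single (i, j) a\<close> is \<open>a e\<^bsub>i,j\<^esub>\<close>. The product
  below is not the (convolution) product of the type of finitely supported functions.
\<close>

definition RD :: "('i \<times> 'i) set \<Rightarrow> (('i \<times> 'i) \<Rightarrow>\<^sub>0 'r::ring_1) set" where
  "RD \<Delta> = {x. Poly_Mapping.keys x \<subseteq> \<Delta>}"

fun basis_mult :: "('i \<times> 'i) set \<Rightarrow> 'i \<times> 'i \<Rightarrow> 'r \<Rightarrow> 'i \<times> 'i \<Rightarrow> 'r
    \<Rightarrow> (('i \<times> 'i) \<Rightarrow>\<^sub>0 'r::ring_1)" where
  "basis_mult \<Delta> (i, j) a (k, l) b =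
     (if j = k \<and> (i, l) \<in> \<Delta> then Poly_Mapping.single (i, l) (a * b) else 0)"

definition RD_mult :: "('i \<times> 'i) set
    \<Rightarrow> (('i \<times> 'i) \<Rightarrow>\<^sub>0 'r::ring_1) \<Rightarrow> (('i \<times> 'i) \<Rightarrow>\<^sub>0 'r) \<Rightarrow> (('i \<times> 'i) \<Rightarrow>\<^sub>0 'r)" where
  "RD_mult \<Delta> x y = (\<Sum>p\<in>Poly_Mapping.keys x. \<Sum>q\<in>Poly_Mapping.keys y.
     basis_mult \<Delta> p (Poly_Mapping.lookup x p) q (Poly_Mapping.lookup y q))"

definition lscale :: "'r::ring_1 \<Rightarrow> ('a \<Rightarrow>\<^sub>0 'r) \<Rightarrow> ('a \<Rightarrow>\<^sub>0 'r)" where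
  "lscale r x = Poly_Mapping.map (\<lambda>c. r * c) x"

definition rscale :: "'r::ring_1 \<Rightarrow> ('a \<Rightarrow>\<^sub>0 'r) \<Rightarrow> ('a \<Rightarrow>\<^sub>0 'r)" where
  "rscale r x = Poly_Mapping.map (\<lambda>c. c * r) x"

text \<open>\<open>(r, x)\<close> stands for \<open>r \<cdot> 1 + x\<close>; scalars act on coefficients from either side.\<close>

definition RD1 :: "('i \<times> 'i) set \<Rightarrow> ('r::ring_1 \<times> (('i \<times> 'i) \<Rightarrow>\<^sub>0 'r)) ring" where
  "RD1 \<Delta> =
    \<lparr>carrier = UNIV \<times> RD \<Delta>,
     mult = (\<lambda>(r, x) (s, y). (r * s, lscale r y + rscale s x + RD_mult \<Delta> x y)),
     one = (1, 0),
     zero = (0, 0),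
     add = (\<lambda>(r, x) (s, y). (r + s, x + y))\<rparr>"

definition GD :: "('i \<times> 'i) set \<Rightarrow> ('r::ring_1 \<times> (('i \<times> 'i) \<Rightarrow>\<^sub>0 'r)) monoid" where
  "GD \<Delta> = (units_of (RD1 \<Delta>))\<lparr>carrier := {(1, x) | x. x \<in> RD \<Delta>}\<rparr>"

definition elementary :: "'i \<Rightarrow> 'i \<Rightarrow> 'r::ring_1 \<Rightarrow> 'r \<times> (('i \<times> 'i) \<Rightarrow>\<^sub>0 'r)" where
  "elementary i j a = (1, Poly_Mapping.single (i, j) a)"

lemma lookup_lscale:
  "Poly_Mapping.lookup (lscale r x) p = (r::'r::ring_1) * Poly_Mapping.lookup x p"
  by (simp add: lscale_def rscale_def Poly_Mapping.map.rep_eq when_def)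

lemma lookup_rscale:
  "Poly_Mapping.lookup (rscale r x) p = Poly_Mapping.lookup x p * (r::'r::ring_1)"
  by (simp add: lscale_def rscale_def Poly_Mapping.map.rep_eq when_def)

lemma basis_mult_zero [simp]: "basis_mult \<Delta> p 0 q b = 0" "basis_mult \<Delta> p a q 0 = 0"
  by (cases p; cases q; simp)+

lemma basis_mult_add:
  "basis_mult \<Delta> p (a + a') q b = basis_mult \<Delta> p a q b + basis_mult \<Delta> p a' q b"
  "basis_mult \<Delta> p a q (b + b') = basis_mult \<Delta> p a q b + basis_mult \<Delta> p a q b'"
  by (cases p; cases q; simp add: distrib_left distrib_right single_add)+

lemma RD_mult_superset:
  assumes "finite A" "Poly_Mapping.keys x \<subseteq> A" "finite B" "Poly_Mapping.keys y \<subseteq> B"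
  shows "RD_mult \<Delta> x y = (\<Sum>p\<in>A. \<Sum>q\<in>B.
     basis_mult \<Delta> p (Poly_Mapping.lookup x p) q (Poly_Mapping.lookup y q))"
proof -
  have "(\<Sum>q\<in>Poly_Mapping.keys y. basis_mult \<Delta> p (Poly_Mapping.lookup x p) q (Poly_Mapping.lookup y q))
    = (\<Sum>q\<in>B. basis_mult \<Delta> p (Poly_Mapping.lookup x p) q (Poly_Mapping.lookup y q))" for p
    using assms by (intro sum.mono_neutral_left) (auto simp: in_keys_iff)
  then show ?thesis
    unfolding RD_mult_def using assms
    by (simp, intro sum.mono_neutral_left) (auto simp: in_keys_iff)
qed

lemma RD_mult_add_left: "RD_mult \<Delta> (x + x') y = RD_mult \<Delta> x y + RD_mult \<Delta> x' y"
proof -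
  let ?A = "Poly_Mapping.keys x \<union> Poly_Mapping.keys x'" and ?B = "Poly_Mapping.keys y"
  have "Poly_Mapping.keys (x + x') \<subseteq> ?A" by (rule keys_add)
  then show ?thesis
    by (subst (1 2 3) RD_mult_superset[of ?A _ ?B])
      (auto simp: lookup_add basis_mult_add sum.distrib)
qed

lemma RD_mult_add_right: "RD_mult \<Delta> x (y + y') = RD_mult \<Delta> x y + RD_mult \<Delta> x y'"
proof -
  let ?B = "Poly_Mapping.keys y \<union> Poly_Mapping.keys y'" and ?A = "Poly_Mapping.keys x"
  have "Poly_Mapping.keys (y + y') \<subseteq> ?B" by (rule keys_add)
  then show ?thesis
    by (subst (1 2 3) RD_mult_superset[of ?A _ ?B])
      (auto simp: lookup_add basis_mult_add sum.distrib)
qed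

lemma RD_mult_single:
  "RD_mult \<Delta> (Poly_Mapping.single p a) (Poly_Mapping.single q b) = basis_mult \<Delta> p a q b"
  by (subst RD_mult_superset[of "{p}" _ "{q}"]) auto

lemma RD_mult_zero [simp]: "RD_mult \<Delta> 0 y = 0" "RD_mult \<Delta> x 0 = 0"
  by (simp_all add: RD_mult_def)

lemma RD_induct [consumes 1, case_names zero add]:
  assumes "x \<in> RD \<Delta>" "P 0"
    and "\<And>p a x. p \<in> \<Delta> \<Longrightarrow> x \<in> RD \<Delta> \<Longrightarrow> P x \<Longrightarrow> P (Poly_Mapping.single p a + x)"
  shows "P x"
proof -
  have "P (\<Sum>p\<in>A. Poly_Mapping.single p (Poly_Mapping.lookup x p))
      \<and> (\<Sum>p\<in>A. Poly_Mapping.single p (Poly_Mapping.lookup x p)) \<in> RD \<Delta>"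
    if "finite A" "A \<subseteq> \<Delta>" for A
    using that
  proof (induction A rule: finite_induct)
    case empty
    then show ?case using assms(2) by (simp add: RD_def)
  next
    case (insert p A)
    let ?s = "\<Sum>p\<in>A. Poly_Mapping.single p (Poly_Mapping.lookup x p)"
    have "Poly_Mapping.keys (Poly_Mapping.single p (Poly_Mapping.lookup x p) + ?s)
      \<subseteq> {p} \<union> Poly_Mapping.keys ?s"
      by (rule order_trans[OF keys_add]) auto
    then show ?case
      using insert assms(3)[of p ?s "Poly_Mapping.lookup x p"] by (auto simp: RD_def)
  qed
  moreover have "(\<Sum>p\<in>Poly_Mapping.keys x. Poly_Mapping.single p (Poly_Mapping.lookup x p)) = x"
    by (rule poly_mapping_eqI)
      (simp add: lookup_sum lookup_single when_def in_keys_iff)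
  ultimately show ?thesis
    using assms(1) unfolding RD_def by (metis finite_keys mem_Collect_eq)
qed

lemma RD_add: "x \<in> RD \<Delta> \<Longrightarrow> y \<in> RD \<Delta> \<Longrightarrow> x + y \<in> RD \<Delta>"
  using keys_add[of x y] by (auto simp: RD_def)

lemma RD_mult_closed: "RD_mult \<Delta> x y \<in> RD \<Delta>"
proof -
  have bm: "basis_mult \<Delta> p a q b \<in> RD \<Delta>" for p q a b
    by (cases p; cases q) (auto simp: RD_def)
  have zero: "0 \<in> RD \<Delta>" by (simp add: RD_def)
  have sums: "(\<Sum>p\<in>A. f p) \<in> RD \<Delta>" if "\<And>p. f p \<in> RD \<Delta>" for f :: "_ \<Rightarrow> (_ \<Rightarrow>\<^sub>0 _)" and A
    using that by (induction A rule: infinite_finite_induct) (auto intro: RD_add zero)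
  show ?thesis
    unfolding RD_mult_def by (intro sums bm)
qed

lemma RD_mult_assoc:
  assumes A2: "axiom_A2 \<Delta>" and xyz: "x \<in> RD \<Delta>" "y \<in> RD \<Delta>" "z \<in> RD \<Delta>"
  shows "RD_mult \<Delta> (RD_mult \<Delta> x y) z = RD_mult \<Delta> x (RD_mult \<Delta> y z)"
proof -
  have sss: "RD_mult \<Delta> (RD_mult \<Delta> (Poly_Mapping.single p a) (Poly_Mapping.single q b)) (Poly_Mapping.single r c)
      = RD_mult \<Delta> (Poly_Mapping.single p a) (RD_mult \<Delta> (Poly_Mapping.single q b) (Poly_Mapping.single r c))"
    if "p \<in> \<Delta>" "q \<in> \<Delta>" "r \<in> \<Delta>" for p q r a b c
  proof -
    obtain i j j' k k' l where pqr: "p = (i, j)" "q = (j', k)" "r = (k', l)"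
      by (metis surj_pair)
    show ?thesis
    proof (cases "j = j' \<and> k = k' \<and> (i, l) \<in> \<Delta>")
      case True
      then have "(i, k) \<in> \<Delta> \<longleftrightarrow> (j, l) \<in> \<Delta>"
        using A2 that unfolding axiom_A2_def pqr by blast
      with True show ?thesis by (simp add: pqr RD_mult_single mult.assoc)
    next
      case False
      then show ?thesis by (auto simp: pqr RD_mult_single)
    qed
  qed
  have ssz: "RD_mult \<Delta> (RD_mult \<Delta> (Poly_Mapping.single p a) (Poly_Mapping.single q b)) z
      = RD_mult \<Delta> (Poly_Mapping.single p a) (RD_mult \<Delta> (Poly_Mapping.single q b) z)"
    if "p \<in> \<Delta>" "q \<in> \<Delta>" for p q a b
    using xyz(3) by (induction z rule: RD_induct) (auto simp: RD_mult_add_right that sss)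
  have syz: "RD_mult \<Delta> (RD_mult \<Delta> (Poly_Mapping.single p a) y) z
      = RD_mult \<Delta> (Poly_Mapping.single p a) (RD_mult \<Delta> y z)"
    if "p \<in> \<Delta>" for p a
    using xyz(2)
    by (induction y rule: RD_induct) (auto simp: RD_mult_add_right RD_mult_add_left that ssz)
  show ?thesis
    using xyz(1) by (induction x rule: RD_induct) (auto simp: RD_mult_add_left syz)
qed

lemma scalar_single:
  "lscale r (Poly_Mapping.single p a) = Poly_Mapping.single p ((r::'r::ring_1) * a)"
  "rscale r (Poly_Mapping.single p a) = Poly_Mapping.single p (a * r)"
  by (rule poly_mapping_eqI; simp add: lookup_lscale lookup_rscale lookup_single when_def)+

lemma scalar_add:
  "lscale r (x + y) = lscale r x + lscale r y"
  "rscale r (x + y) = rscale r x + rscale r y"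
  "lscale (r + s) x = lscale r x + lscale s x"
  "rscale (r + s) x = rscale r x + rscale s x"
  by (rule poly_mapping_eqI;
      simp add: lookup_lscale lookup_rscale lookup_add distrib_left distrib_right)+

lemma scalar_scalar:
  "lscale r (lscale s x) = lscale (r * s) x"
  "rscale r (rscale s x) = rscale (s * r) x"
  "rscale r (lscale s x) = lscale s (rscale r x)"
  by (rule poly_mapping_eqI; simp add: lookup_lscale lookup_rscale mult.assoc)+

lemma scalar_id [simp]:
  "lscale 0 x = (0 :: _ \<Rightarrow>\<^sub>0 'r::ring_1)"
  "rscale 0 x = (0 :: _ \<Rightarrow>\<^sub>0 'r::ring_1)"
  "lscale 1 x = (x :: _ \<Rightarrow>\<^sub>0 'r::ring_1)"
  "rscale 1 x = (x :: _ \<Rightarrow>\<^sub>0 'r::ring_1)"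
  "lscale r 0 = (0 :: _ \<Rightarrow>\<^sub>0 'r::ring_1)"
  "rscale r 0 = (0 :: _ \<Rightarrow>\<^sub>0 'r::ring_1)"
  by (rule poly_mapping_eqI; simp add: lookup_lscale lookup_rscale)+

lemma RD_scalar:
  "x \<in> RD \<Delta> \<Longrightarrow> lscale r x \<in> RD \<Delta>"
  "x \<in> RD \<Delta> \<Longrightarrow> rscale r x \<in> RD \<Delta>"
  unfolding RD_def subset_iff in_keys_iff lookup_lscale lookup_rscale mem_Collect_eq
  by (metis mult_zero_right, metis mult_zero_left)

lemma basis_mult_scalar:
  "basis_mult \<Delta> p (r * a) q b = lscale r (basis_mult \<Delta> p a q b)"
  "basis_mult \<Delta> p a q (b * r) = rscale r (basis_mult \<Delta> p a q b)"
  "basis_mult \<Delta> p (a * r) q b = basis_mult \<Delta> p a q (r * b)"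
  by (cases p; cases q; simp add: scalar_single mult.assoc)+

lemma RD_mult_scalar:
  assumes "x \<in> RD \<Delta>" "y \<in> RD \<Delta>"
  shows "RD_mult \<Delta> (lscale r x) y = lscale r (RD_mult \<Delta> x y)"
    and "RD_mult \<Delta> x (rscale r y) = rscale r (RD_mult \<Delta> x y)"
    and "RD_mult \<Delta> (rscale r x) y = RD_mult \<Delta> x (lscale r y)"
proof -
  note bilinear = RD_mult_add_left RD_mult_add_right scalar_add scalar_single
    RD_mult_single basis_mult_scalar(1,2)
  have "RD_mult \<Delta> (lscale r (Poly_Mapping.single p a)) y
      = lscale r (RD_mult \<Delta> (Poly_Mapping.single p a) y)" for p a
    using assms(2) by (induction y rule: RD_induct) (simp_all add: bilinear)
  with assms(1) show "RD_mult \<Delta> (lscale r x) y = lscale r (RD_mult \<Delta> x y)"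
    by (induction x rule: RD_induct) (simp_all add: RD_mult_add_left scalar_add)
  have "RD_mult \<Delta> (Poly_Mapping.single p a) (rscale r y)
      = rscale r (RD_mult \<Delta> (Poly_Mapping.single p a) y)" for p a
    using assms(2) by (induction y rule: RD_induct) (simp_all add: bilinear)
  with assms(1) show "RD_mult \<Delta> x (rscale r y) = rscale r (RD_mult \<Delta> x y)"
    by (induction x rule: RD_induct) (simp_all add: RD_mult_add_left scalar_add)
  have "RD_mult \<Delta> (rscale r (Poly_Mapping.single p a)) y
      = RD_mult \<Delta> (Poly_Mapping.single p a) (lscale r y)" for p a
    using assms(2) by (induction y rule: RD_induct)
      (simp_all add: RD_mult_add_right scalar_add scalar_single RD_mult_single basis_mult_scalar(3))
  with assms(1) show "RD_mult \<Delta> (rscale r x) y = RD_mult \<Delta> x (lscale r y)"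
    by (induction x rule: RD_induct) (simp_all add: RD_mult_add_left scalar_add)
qed

lemma ring_RD1:
  fixes \<Delta> :: "('i \<times> 'i) set"
  assumes "axiom_A2 \<Delta>"
  shows "ring (RD1 \<Delta> :: ('r::ring_1 \<times> (('i \<times> 'i) \<Rightarrow>\<^sub>0 'r)) ring)"
proof (rule ringI)
  let ?A = "RD1 \<Delta> :: ('r \<times> (('i \<times> 'i) \<Rightarrow>\<^sub>0 'r)) ring"
  have minus: "- x \<in> RD \<Delta>" if "x \<in> RD \<Delta>" for x :: "('i \<times> 'i) \<Rightarrow>\<^sub>0 'r"
    using that by (simp add: RD_def)
  have zero: "0 \<in> RD \<Delta>" by (simp add: RD_def)
  show "abelian_group ?A"
  proof (rule abelian_groupI)
    show "\<exists>y\<in>carrier ?A. y \<oplus>\<^bsub>?A\<^esub> x = \<zero>\<^bsub>?A\<^esub>" if "x \<in> carrier ?A" for x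
      using that by (intro bexI[of _ "(- fst x, - snd x)"]) (auto simp: RD1_def minus)
  qed (auto simp: RD1_def RD_add zero algebra_simps)
  show "monoid ?A"
    by (rule monoidI)
      (auto simp: RD1_def RD_add RD_scalar RD_mult_closed zero RD_mult_add_left RD_mult_add_right
        RD_mult_scalar RD_mult_assoc[OF assms] scalar_add scalar_scalar mult.assoc add_ac)
qed (auto simp: RD1_def RD_mult_add_left RD_mult_add_right scalar_add algebra_simps)

section \<open>The defining relations\<close>

text \<open>The symbol \<open>x\<^bsub>i,j\<^esub>(a)\<close> is \<open>((i, j), a)\<close>, with \<open>(i, j) \<in> \<Delta>\<close>.\<close>

definition symbols :: "('i \<times> 'i) set \<Rightarrow> (('i \<times> 'i) \<times> 'r) set" where
  "symbols \<Delta> = \<Delta> \<times> UNIV"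

definition sym_gen :: "('i \<times> 'i) set \<Rightarrow> 'i \<Rightarrow> 'i \<Rightarrow> 'r
    \<Rightarrow> ((('i \<times> 'i) \<times> 'r) \<times> bool) list set" where
  "sym_gen \<Delta> i j a = free_gen (symbols \<Delta>) ((i, j), a)"

definition relations :: "('i \<times> 'i) set
    \<Rightarrow> (((('i \<times> 'i) \<times> 'r::ring_1) \<times> bool) list set
        \<times> ((('i \<times> 'i) \<times> 'r) \<times> bool) list set) set" where
  "relations \<Delta> = (let F = free_group (symbols \<Delta>); x = sym_gen \<Delta> in
     {(commutator F (x i j a) (x j k b), x i k (a * b)) | i j k a b.
        (i, j) \<in> \<Delta> \<and> (j, k) \<in> \<Delta> \<and> (i, k) \<in> \<Delta>}
   \<union> {(commutator F (x i j a) (x j k b), \<one>\<^bsub>F\<^esub>) | i j k a b.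
        (i, j) \<in> \<Delta> \<and> (j, k) \<in> \<Delta> \<and> (i, k) \<notin> \<Delta>}
   \<union> {(commutator F (x i j a) (x k l b), \<one>\<^bsub>F\<^esub>) | i j k l a b.
        (i, j) \<in> \<Delta> \<and> (k, l) \<in> \<Delta> \<and> j \<noteq> k \<and> i \<noteq> l}
   \<union> {(x i j a \<otimes>\<^bsub>F\<^esub> x i j b, x i j (a + b)) | i j a b. (i, j) \<in> \<Delta>})"

end

theory Submission
  imports Defs "HOL-Algebra.Generated_Groups"
begin

text \<open>
  Each element of the presented group involves only finitely many indices, hence only generators
  \<open>x\<^bsub>p\<^esub>(a)\<close> with \<open>p\<close> in a finite set \<open>S \<subseteq> \<Delta>\<close> closed under products. Such a nonempty \<open>S\<close>
  contains a \<open>p\<close> that is not a product of two elements of \<open>S\<close>, and \<open>S - {p}\<close> is again closed. The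
  commutator relations let every word over \<open>S\<close> be rewritten as \<open>x\<^bsub>p\<^esub>(a) h'\<close> with \<open>h'\<close> a word over
  \<open>S - {p}\<close>. The coefficient at \<open>p\<close> of its image in \<open>G(\<Delta>)\<close> is \<open>a\<close>, so if the image is trivial then
  \<open>a = 0\<close>, and induction on \<open>S\<close> shows that the word is trivial. The same removal of \<open>p\<close> factorises
  elements of \<open>G(\<Delta>)\<close>, which gives inverses and generation.
\<close>

section \<open>Homomorphisms out of presented groups\<close>

fun letter_val :: "('a, 'b) monoid_scheme \<Rightarrow> ('g \<Rightarrow> 'a) \<Rightarrow> 'g \<times> bool \<Rightarrow> 'a" where
  "letter_val G f (g, b) = (if b then f g else inv\<^bsub>G\<^esub> f g)"

definition word_val :: "('a, 'b) monoid_scheme \<Rightarrow> ('g \<Rightarrow> 'a) \<Rightarrow> ('g \<times> bool) list \<Rightarrow> 'a" where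
  "word_val G f w = foldr (\<lambda>l a. letter_val G f l \<otimes>\<^bsub>G\<^esub> a) w \<one>\<^bsub>G\<^esub>"

text \<open>Elements of the free group are classes of words. \<open>the_elem\<close> picks the value
  shared by all words of a class; it is well defined for \<open>f\<close> into the carrier of a
  group because \<open>word_val\<close> then respects \<open>free_eq\<close>.\<close>

definition free_lift :: "('a, 'b) monoid_scheme \<Rightarrow> ('g \<Rightarrow> 'a) \<Rightarrow> ('g \<times> bool) list set \<Rightarrow> 'a" where
  "free_lift G f A = the_elem (word_val G f ` A)"

definition presented_gen ::
  "'g set \<Rightarrow> (('g \<times> bool) list set \<times> ('g \<times> bool) list set) set \<Rightarrow> 'g \<Rightarrow> ('g \<times> bool) list set set"
  where
  "presented_gen X Rel s = relator_closure X Rel #>\<^bsub>free_group X\<^esub> free_gen X s"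

context group
begin

lemma word_val_simps [simp]:
  "word_val G f [] = \<one>"
  "word_val G f (l # w) = letter_val G f l \<otimes> word_val G f w"
  by (simp_all add: word_val_def)

lemma letter_val_closed: "f \<in> X \<rightarrow> carrier G \<Longrightarrow> l \<in> X \<times> UNIV \<Longrightarrow> letter_val G f l \<in> carrier G"
  by (cases l) auto

lemma word_val_closed: "f \<in> X \<rightarrow> carrier G \<Longrightarrow> w \<in> words X \<Longrightarrow> word_val G f w \<in> carrier G"
  by (induction w) (auto simp: words_def letter_val_closed simp del: letter_val.simps)

lemma word_val_append:
  assumes "f \<in> X \<rightarrow> carrier G" "u \<in> words X" "v \<in> words X"
  shows "word_val G f (u @ v) = word_val G f u \<otimes> word_val G f v"
  using assms(2)
proof (induction u)
  case (Cons l u)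
  then have "l \<in> X \<times> UNIV" "u \<in> words X" by (auto simp: words_def)
  with Cons.IH assms show ?case
    by (simp add: m_assoc word_val_closed letter_val_closed)
qed (use assms in \<open>simp add: word_val_closed\<close>)

lemma word_val_free_eq:
  assumes "f \<in> X \<rightarrow> carrier G" "(u, v) \<in> free_eq X"
  shows "word_val G f u = word_val G f v"
  using assms(2)
proof (induction rule: free_eq.induct)
  case (cancel u v g b)
  then have "[(g, b), (g, \<not> b)] @ v \<in> words X" and g: "f g \<in> carrier G"
    using assms(1) by (auto simp: words_def)
  then have "word_val G f (u @ [(g, b), (g, \<not> b)] @ v)
      = word_val G f u \<otimes> word_val G f ([(g, b), (g, \<not> b)] @ v)"
    using cancel assms(1) word_val_append by blast
  also have "word_val G f ([(g, b), (g, \<not> b)] @ v) = word_val G f v"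
    using g word_val_closed[OF assms(1) cancel(2)] by (cases b) (simp_all add: m_assoc[symmetric])
  also have "word_val G f u \<otimes> word_val G f v = word_val G f (u @ v)"
    using cancel assms(1) word_val_append by metis
  finally show ?case .
qed auto

lemma free_lift_class:
  assumes "f \<in> X \<rightarrow> carrier G" "w \<in> words X"
  shows "free_lift G f (free_eq X `` {w}) = word_val G f w"
proof -
  have "word_val G f ` (free_eq X `` {w}) = {word_val G f w}"
  proof (intro equalityI subsetI)
    fix a assume "a \<in> word_val G f ` (free_eq X `` {w})"
    then obtain v where "(w, v) \<in> free_eq X" "a = word_val G f v" by blast
    then show "a \<in> {word_val G f w}" using word_val_free_eq[OF assms(1)] by simp
  qed (use assms free_eq.refl[of w X] in blast)
  then show ?thesis by (simp add: free_lift_def)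
qed

lemma free_lift_hom:
  assumes "f \<in> X \<rightarrow> carrier G"
  shows "free_lift G f \<in> hom (free_group X) G"
proof (rule homI)
  have car: "carrier (free_group X) = words X // free_eq X" by (simp add: free_group_def)
  fix A assume "A \<in> carrier (free_group X)"
  then obtain u where u: "u \<in> words X" "A = free_eq X `` {u}" by (auto simp: car elim: quotientE)
  show "free_lift G f A \<in> carrier G"
    using u assms by (simp add: free_lift_class word_val_closed)
  fix B assume "B \<in> carrier (free_group X)"
  then obtain v where v: "v \<in> words X" "B = free_eq X `` {v}" by (auto simp: car elim: quotientE)
  show "free_lift G f (A \<otimes>\<^bsub>free_group X\<^esub> B) = free_lift G f A \<otimes> free_lift G f B"
    using u v assms
    by (simp add: free_group_mult_class free_lift_class words_append word_val_append)
qed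

lemma free_lift_gen: "f \<in> X \<rightarrow> carrier G \<Longrightarrow> s \<in> X \<Longrightarrow> free_lift G f (free_gen X s) = f s"
  unfolding free_gen_def by (subst free_lift_class) (auto simp: words_def dest: funcset_mem)

end

lemma free_gen_closed: "s \<in> X \<Longrightarrow> free_gen X s \<in> carrier (free_group X)"
  by (auto simp: free_gen_def free_group_def words_def intro!: quotientI)

text \<open>Keeping track of the letters of \<open>w\<close> is what later reduces questions about
  the presented group to finitely many generators.\<close>

lemma class_in_generate_free_gen:
  assumes "w \<in> words X"
  shows "free_eq X `` {w} \<in> generate (free_group X) (free_gen X ` fst ` set w)"
proof -
  interpret F: group "free_group X" by (rule group_free_group)
  \<comment> \<open>A tail may have fewer letters than the word, so the induction runs with a fixed
    superset \<open>Y\<close> of the letters.\<close>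
  have "free_eq X `` {w} \<in> generate (free_group X) (free_gen X ` Y)" if "fst ` set w \<subseteq> Y" for Y
    using assms that
  proof (induction w)
    case Nil
    then show ?case
      using generate.one[of "free_group X"] by (simp add: free_group_def)
  next
    case (Cons l w)
    obtain g b where l: "l = (g, b)" by (cases l)
    have g: "g \<in> X" "g \<in> Y" and w: "w \<in> words X" using Cons.prems l by (auto simp: words_def)
    have sgl: "[(g, c)] \<in> words X" for c using g by (simp add: words_def)
    \<comment> \<open>The class of the formal inverse letter is a left inverse of
      \<open>free_gen X g\<close>, hence its group inverse.\<close>
    have "free_eq X `` {[(g, False)]} \<otimes>\<^bsub>free_group X\<^esub> free_gen X g = \<one>\<^bsub>free_group X\<^esub>"
      using g free_eq.cancel[of "[]" X "[]" g False] sgl equiv_class_eq[OF equiv_free_eq]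
      unfolding free_gen_def by (subst free_group_mult_class) (auto simp: free_group_def words_def)
    then have "inv\<^bsub>free_group X\<^esub> free_gen X g = free_eq X `` {[(g, False)]}"
      using g sgl quotientI[of "[(g, False)]" "words X" "free_eq X"]
      by (intro F.inv_equality free_gen_closed) (simp_all add: free_group_def)
    then have "free_eq X `` {[l]} \<in> generate (free_group X) (free_gen X ` Y)"
      using generate.incl[of "free_gen X g" "free_gen X ` Y" "free_group X"]
        generate.inv[of "free_gen X g" "free_gen X ` Y" "free_group X"] g
      unfolding l by (cases b) (auto simp: free_gen_def)
    from generate.eng[OF this Cons.IH[OF w]] Cons.prems sgl w show ?case
      by (simp add: free_group_mult_class l)
  qed
  then show ?thesis by blast
qed

section \<open>Presented groups: finitely generated pieces and a criterion for presentations\<close>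

locale presentation =
  fixes X :: "'g set" and Rel :: "(('g \<times> bool) list set \<times> ('g \<times> bool) list set) set"
  assumes Rel: "Rel \<subseteq> carrier (free_group X) \<times> carrier (free_group X)"
begin

sublocale F: group "free_group X" by (rule group_free_group)

lemma relators_closed:
  "{u \<otimes>\<^bsub>free_group X\<^esub> inv\<^bsub>free_group X\<^esub> v | u v. (u, v) \<in> Rel} \<subseteq> carrier (free_group X)"
  using Rel by blast

sublocale N: normal "relator_closure X Rel" "free_group X"
  unfolding relator_closure_def by (rule F.normal_closure_normal) (rule relators_closed)

sublocale P: group "presented_group X Rel"
  using Rel by (rule presented_group_group)

sublocale proj: group_hom "free_group X" "presented_group X Rel"
    "r_coset (free_group X) (relator_closure X Rel)"
  unfolding group_hom_def group_hom_axioms_def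
  using N.r_coset_hom_Mod P.group_axioms F.group_axioms by (simp add: presented_group_def)

lemma presented_gen_closed: "s \<in> X \<Longrightarrow> presented_gen X Rel s \<in> carrier (presented_group X Rel)"
  by (simp add: presented_gen_def free_gen_closed)

text \<open>The relator u v^-1 lies in the normal closure, so its coset is trivial and the
  projection identifies \<open>u\<close> with \<open>v\<close>.\<close>

lemma relation_holds:
  assumes "(u, v) \<in> Rel"
  shows "relator_closure X Rel #>\<^bsub>free_group X\<^esub> u = relator_closure X Rel #>\<^bsub>free_group X\<^esub> v"
proof -
  have uv: "u \<in> carrier (free_group X)" "v \<in> carrier (free_group X)" using assms Rel by auto
  have "u \<otimes>\<^bsub>free_group X\<^esub> inv\<^bsub>free_group X\<^esub> v \<in> relator_closure X Rel"
    using assms unfolding relator_closure_def normal_closure_def by blast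
  then have "relator_closure X Rel #>\<^bsub>free_group X\<^esub> (u \<otimes>\<^bsub>free_group X\<^esub> inv\<^bsub>free_group X\<^esub> v)
      = relator_closure X Rel"
    using uv by (intro F.coset_join2 N.subgroup_axioms) auto
  then have "(relator_closure X Rel #>\<^bsub>free_group X\<^esub> u) \<otimes>\<^bsub>presented_group X Rel\<^esub>
      inv\<^bsub>presented_group X Rel\<^esub> (relator_closure X Rel #>\<^bsub>free_group X\<^esub> v) = \<one>\<^bsub>presented_group X Rel\<^esub>"
    using uv by (simp flip: proj.hom_inv proj.hom_mult) (simp add: presented_group_def)
  then show ?thesis
    using uv by (simp add: P.inv_solve_right')
qed

lemma presented_group_generated:
  assumes "q \<in> carrier (presented_group X Rel)"
  obtains Y where "finite Y" "Y \<subseteq> X" "q \<in> generate (presented_group X Rel) (presented_gen X Rel ` Y)"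
proof -
  obtain A where A: "A \<in> carrier (free_group X)" "q = relator_closure X Rel #>\<^bsub>free_group X\<^esub> A"
    using assms by (auto simp: presented_group_def FactGroup_def RCOSETS_def)
  then obtain w where w: "w \<in> words X" "A = free_eq X `` {w}"
    by (auto simp: free_group_def elim: quotientE)
  let ?Y = "fst ` set w"
  have Y: "?Y \<subseteq> X" using w by (auto simp: words_def)
  then have "free_gen X ` ?Y \<subseteq> carrier (free_group X)" by (auto intro: free_gen_closed)
  from proj.generate_img[OF this] class_in_generate_free_gen[OF w(1)]
  have "q \<in> generate (presented_group X Rel) (presented_gen X Rel ` ?Y)"
    unfolding A(2) w(2) presented_gen_def image_image by blast
  with Y that show thesis by blast
qed

text \<open>By \<open>rel\<close>, the lift of \<open>f\<close> factors through the presented group,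
  and \<open>gen\<close> makes the induced map onto. Injectivity may be tested on subgroups
  generated by finitely many symbols, since every element of the presented group lies in one of
  them.\<close>

lemma is_presentationI:
  fixes G (structure)
  assumes "group G" and f: "f \<in> X \<rightarrow> carrier G"
    and rel: "\<And>u v. (u, v) \<in> Rel \<Longrightarrow> free_lift G f u = free_lift G f v"
    and gen: "carrier G \<subseteq> generate G (f ` X)"
    and inj: "\<And>\<psi> Y q. finite Y \<Longrightarrow> Y \<subseteq> X \<Longrightarrow> \<psi> \<in> hom (presented_group X Rel) G
      \<Longrightarrow> (\<And>s. s \<in> X \<Longrightarrow> \<psi> (presented_gen X Rel s) = f s)
      \<Longrightarrow> q \<in> generate (presented_group X Rel) (presented_gen X Rel ` Y)
      \<Longrightarrow> \<psi> q = \<one> \<Longrightarrow> q = \<one>\<^bsub>presented_group X Rel\<^esub>"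
  shows "is_presentation G X f Rel"
proof -
  interpret G: group G by fact
  interpret lift: group_hom "free_group X" G "free_lift G f"
    unfolding group_hom_def group_hom_axioms_def
    using F.group_axioms G.group_axioms G.free_lift_hom[OF f] by simp
  have "u \<otimes>\<^bsub>free_group X\<^esub> inv\<^bsub>free_group X\<^esub> v \<in> kernel (free_group X) G (free_lift G f)"
    if "(u, v) \<in> Rel" for u v
  proof -
    have "u \<in> carrier (free_group X)" "v \<in> carrier (free_group X)" using that Rel by auto
    with rel[OF that] show ?thesis by (simp add: kernel_def)
  qed
  \<comment> \<open>The kernel is a normal subgroup containing all relators, hence one of the sets
    intersected in the normal closure.\<close>
  then have "relator_closure X Rel \<subseteq> kernel (free_group X) G (free_lift G f)"
    unfolding relator_closure_def normal_closure_def using lift.normal_kernel by blast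
  from lift.FactGroup_universal_kernel[OF N.normal_axioms this] obtain \<psi>
    where \<psi>: "\<psi> \<in> hom (presented_group X Rel) G"
      "\<And>x. x \<in> carrier (free_group X) \<Longrightarrow> \<psi> (relator_closure X Rel #>\<^bsub>free_group X\<^esub> x) = free_lift G f x"
    unfolding presented_group_def by blast
  interpret \<psi>: group_hom "presented_group X Rel" G \<psi>
    unfolding group_hom_def group_hom_axioms_def
    using P.group_axioms G.group_axioms \<psi>(1) by simp
  have \<psi>_gen: "\<psi> (presented_gen X Rel s) = f s" if "s \<in> X" for s
    using that \<psi>(2)[OF free_gen_closed[OF that]] G.free_lift_gen[OF f that]
    by (simp add: presented_gen_def)
  have "q = \<one>\<^bsub>presented_group X Rel\<^esub>" if "q \<in> carrier (presented_group X Rel)" "\<psi> q = \<one>" for q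
    using presented_group_generated[OF that(1)] inj[OF _ _ \<psi>(1) \<psi>_gen] that(2) by metis
  then have "inj_on \<psi> (carrier (presented_group X Rel))"
    unfolding \<psi>.inj_on_one_iff by blast
  moreover have "carrier G \<subseteq> \<psi> ` carrier (presented_group X Rel)"
  proof -
    have "f ` X \<subseteq> \<psi> ` carrier (presented_group X Rel)"
      using \<psi>_gen presented_gen_closed by (metis image_subset_iff image_eqI)
    then have "generate G (f ` X) \<subseteq> \<psi> ` carrier (presented_group X Rel)"
      using \<psi>.img_is_subgroup by (rule G.generate_subgroup_incl)
    with gen show ?thesis by blast
  qed
  ultimately have "\<psi> \<in> iso (presented_group X Rel) G"
    using \<psi>(1) by (auto simp: iso_def bij_betw_def)
  with \<open>group G\<close> f \<psi>_gen show ?thesis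
    unfolding is_presentation_def presented_gen_def by blast
qed

end

section \<open>Finite closed sets of positions\<close>

text \<open>
  With \<open>T = S\<close> this says that \<open>S\<close> is closed in \<open>\<Delta>\<close>, with \<open>T = S - {p}\<close> also that \<open>p\<close> is
  indecomposable in \<open>S\<close>.
\<close>

definition products_in :: "('i \<times> 'i) set \<Rightarrow> ('i \<times> 'i) set \<Rightarrow> ('i \<times> 'i) set \<Rightarrow> bool" where
  "products_in \<Delta> S T \<longleftrightarrow> (\<forall>i j k. (i, j) \<in> S \<longrightarrow> (j, k) \<in> S \<longrightarrow> (i, k) \<in> \<Delta> \<longrightarrow> (i, k) \<in> T)"

lemma products_in_mono: "products_in \<Delta> S T \<Longrightarrow> S' \<subseteq> S \<Longrightarrow> T \<subseteq> T' \<Longrightarrow> products_in \<Delta> S' T'"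
  unfolding products_in_def by blast

text \<open>
  For fixed \<open>i\<close>, axiom (A2) makes \<open>j < k \<longleftrightarrow> (j, k) \<in> S\<close> a strict partial order on
  \<open>{k. (i, k) \<in> S}\<close>; a minimal \<open>k\<close> yields an indecomposable pair \<open>(i, k)\<close>.
\<close>

lemma exists_indecomposable:
  assumes "irrefl \<Delta>" "axiom_A2 \<Delta>" "finite S" "S \<subseteq> \<Delta>" "products_in \<Delta> S S" "S \<noteq> {}"
  obtains p where "p \<in> S" "products_in \<Delta> S (S - {p})"
proof -
  obtain i m where im: "(i, m) \<in> S" using \<open>S \<noteq> {}\<close> by auto
  define r where "r = {(j, k) \<in> S. (i, j) \<in> S \<and> (i, k) \<in> S}"
  have "trans r"
  proof (rule transI)
    fix j k l assume jkl: "(j, k) \<in> r" "(k, l) \<in> r"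
    then have "(i, j) \<in> \<Delta> \<and> (j, k) \<in> \<Delta> \<and> (k, l) \<in> \<Delta> \<and> (i, l) \<in> \<Delta>" "(i, k) \<in> \<Delta>"
      using \<open>S \<subseteq> \<Delta>\<close> by (auto simp: r_def)
    then have "(j, l) \<in> \<Delta>" using \<open>axiom_A2 \<Delta>\<close> unfolding axiom_A2_def by blast
    with jkl show "(j, l) \<in> r"
      using \<open>products_in \<Delta> S S\<close> unfolding products_in_def r_def by blast
  qed
  moreover have "irrefl r" using assms by (auto simp: irrefl_def r_def)
  moreover have "finite r" by (rule finite_subset[OF _ \<open>finite S\<close>]) (auto simp: r_def)
  ultimately have "wf r" by (intro finite_acyclic_wf) (simp_all add: acyclic_irrefl)
  \<comment> \<open>Here \<open>k\<close> is minimal for \<open>r\<close>. A factorisation of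
    \<open>(i, k)\<close> through some \<open>j\<close> inside \<open>S\<close> would put
    \<open>(j, k)\<close> into \<open>r\<close> with \<open>(i, j)\<close> in \<open>S\<close>,
    against minimality.\<close>
  then obtain k where k: "(i, k) \<in> S" "\<And>j. (j, k) \<in> r \<Longrightarrow> (i, j) \<notin> S"
    using wfE_min[of r m "{k. (i, k) \<in> S}"] im by auto
  then have "products_in \<Delta> S (S - {(i, k)})"
    using \<open>products_in \<Delta> S S\<close> unfolding products_in_def r_def by blast
  with k(1) show thesis by (rule that)
qed

text \<open>Removing an indecomposable \<open>p\<close> keeps the set closed, since products of two
  elements of \<open>S\<close> never hit \<open>p\<close>. So a finite closed set can be exhausted
  one position at a time; inverses and generation in \<open>GD \<Delta>\<close> and the trivial
  kernel all rest on this.\<close>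

lemma closed_set_induct [consumes 5, case_names empty remove]:
  assumes "irrefl \<Delta>" "axiom_A2 \<Delta>" "finite S" "S \<subseteq> \<Delta>" "products_in \<Delta> S S"
    and "P {}"
    and "\<And>S p. S \<subseteq> \<Delta> \<Longrightarrow> p \<in> S \<Longrightarrow> products_in \<Delta> S (S - {p}) \<Longrightarrow> P (S - {p}) \<Longrightarrow> P S"
  shows "P S"
  using assms(3-5)
proof (induction rule: finite_psubset_induct)
  case (psubset S)
  show ?case
  proof (cases "S = {}")
    case False
    then obtain p where p: "p \<in> S" "products_in \<Delta> S (S - {p})"
      using exists_indecomposable[OF assms(1,2) psubset.hyps psubset.prems] by blast
    have closed: "products_in \<Delta> (S - {p}) (S - {p})"
      by (rule products_in_mono[OF p(2)]) auto
    have "P (S - {p})"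
    proof (rule psubset.IH)
      show "S - {p} \<subset> S" using p(1) by blast
      show "S - {p} \<subseteq> \<Delta>" using psubset.prems(1) by blast
    qed (rule closed)
    with psubset.prems(1) p show ?thesis by (rule assms(7))
  qed (simp add: assms(6))
qed

text \<open>The positions of \<open>\<Delta>\<close> whose two indices both occur in
  \<open>A\<close> form a finite set, and a product introduces no new index.\<close>

lemma finite_subset_closed_set:
  assumes "finite A" "A \<subseteq> \<Delta>"
  obtains S where "finite S" "A \<subseteq> S" "S \<subseteq> \<Delta>" "products_in \<Delta> S S"
proof
  let ?V = "fst ` A \<union> snd ` A"
  show "finite (\<Delta> \<inter> ?V \<times> ?V)" using assms by blast
  show "A \<subseteq> \<Delta> \<inter> ?V \<times> ?V" using assms by force
  show "\<Delta> \<inter> ?V \<times> ?V \<subseteq> \<Delta>" by blast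
  show "products_in \<Delta> (\<Delta> \<inter> ?V \<times> ?V) (\<Delta> \<inter> ?V \<times> ?V)" unfolding products_in_def by blast
qed

section \<open>The group \<open>G(\<Delta>)\<close>\<close>

text \<open>With \<open>T = S - {p}\<close> this says that a product of two elements supported in
  \<open>S\<close> has coefficient 0 at an indecomposable \<open>p\<close>.\<close>

lemma RD_mult_in_RD:
  assumes "x \<in> RD S" "y \<in> RD S" "products_in \<Delta> S T"
  shows "RD_mult \<Delta> x y \<in> RD T"
proof -
  have sums: "(\<Sum>p\<in>A. f p) \<in> RD T" if "\<And>p. p \<in> A \<Longrightarrow> f p \<in> RD T"
    for f :: "_ \<Rightarrow> (_ \<Rightarrow>\<^sub>0 _)" and A
    using that
  proof (induction A rule: infinite_finite_induct)
    case (insert q A)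
    then show ?case by (auto intro: RD_add)
  qed (simp_all add: RD_def)
  have "basis_mult \<Delta> p a q b \<in> RD T" if "p \<in> S" "q \<in> S" for p q a b
    using that assms(3) unfolding products_in_def by (cases p; cases q) (auto simp: RD_def)
  moreover have "Poly_Mapping.keys x \<subseteq> S" "Poly_Mapping.keys y \<subseteq> S"
    using assms(1,2) by (simp_all add: RD_def)
  ultimately show ?thesis
    unfolding RD_mult_def by (intro sums) blast
qed

lemma RD_minus: "x \<in> RD S \<Longrightarrow> y \<in> RD S \<Longrightarrow> x - y \<in> RD S"
  using keys_diff[of x y] by (auto simp: RD_def)

lemma RD_mono: "S \<subseteq> T \<Longrightarrow> RD S \<subseteq> RD T"
  by (auto simp: RD_def)

lemma RD_single: "p \<in> S \<Longrightarrow> Poly_Mapping.single p a \<in> RD S"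
  by (auto simp: RD_def)

lemma RD_mult_single_self:
  assumes "irrefl \<Delta>" "p \<in> \<Delta>"
  shows "RD_mult \<Delta> (Poly_Mapping.single p a) (Poly_Mapping.single p b) = 0"
  using assms by (cases p) (auto simp: RD_mult_single irrefl_def)

section \<open>Factorisation, inverses and generators in G(\<Delta>)\<close>

lemma carrier_GD: "carrier (GD \<Delta>) = Pair 1 ` RD \<Delta>"
  by (auto simp: GD_def)

lemma one_GD: "\<one>\<^bsub>GD \<Delta>\<^esub> = (1, 0)"
  by (simp add: GD_def units_of_def RD1_def)

lemma mult_GD: "mult (GD \<Delta>) = mult (RD1 \<Delta>)"
  by (simp add: GD_def units_of_def)

lemma GD_mult: "(1, x) \<otimes>\<^bsub>GD \<Delta>\<^esub> (1, y) = (1, x + y + RD_mult \<Delta> x y)"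
  by (simp add: mult_GD RD1_def add.commute)

lemma GD_m_assoc:
  assumes "axiom_A2 \<Delta>" "u \<in> carrier (GD \<Delta>)" "v \<in> carrier (GD \<Delta>)" "w \<in> carrier (GD \<Delta>)"
  shows "u \<otimes>\<^bsub>GD \<Delta>\<^esub> v \<otimes>\<^bsub>GD \<Delta>\<^esub> w = u \<otimes>\<^bsub>GD \<Delta>\<^esub> (v \<otimes>\<^bsub>GD \<Delta>\<^esub> w)"
  using assms
  by (auto simp: carrier_GD GD_mult RD_mult_add_left RD_mult_add_right RD_mult_assoc add_ac)

lemma GD_m_closed:
  "u \<in> carrier (GD \<Delta>) \<Longrightarrow> v \<in> carrier (GD \<Delta>) \<Longrightarrow> u \<otimes>\<^bsub>GD \<Delta>\<^esub> v \<in> carrier (GD \<Delta>)"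
  by (auto simp: carrier_GD GD_mult RD_add RD_mult_closed)

text \<open>Let s = a e_p with a the coefficient of \<open>x\<close> at \<open>p\<close>. Since s s
  = 0, the inverse of 1 + s is 1 - s, so \<open>x'\<close> is forced by 1 + x' = (1 - s)(1 +
  x).\<close>

lemma GD_peel:
  assumes "irrefl \<Delta>" "axiom_A2 \<Delta>" "S \<subseteq> \<Delta>" "p \<in> S" "products_in \<Delta> S (S - {p})" "x \<in> RD S"
  obtains a x' where "x' \<in> RD (S - {p})"
    "(1, x) = (1, Poly_Mapping.single p a) \<otimes>\<^bsub>GD \<Delta>\<^esub> (1, x')"
proof -
  define s where "s = Poly_Mapping.single p (Poly_Mapping.lookup x p)"
  define x' where "x' = x - s - RD_mult \<Delta> s x"
  have s: "s \<in> RD S" using assms by (simp add: s_def RD_single)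
  \<comment> \<open>Subtracting \<open>s\<close> clears the coefficient at \<open>p\<close>, and s x
    has none there because \<open>p\<close> is indecomposable.\<close>
  have "x - s \<in> RD S" "Poly_Mapping.lookup (x - s) p = 0"
    using assms s by (simp_all add: RD_minus s_def lookup_minus)
  then have "x - s \<in> RD (S - {p})" by (auto simp: RD_def in_keys_iff)
  then have x': "x' \<in> RD (S - {p})"
    unfolding x'_def using RD_mult_in_RD[OF s assms(6,5)] by (rule RD_minus)
  have "s \<in> RD \<Delta>" "x \<in> RD \<Delta>" using s assms RD_mono by blast+
  moreover have ss: "RD_mult \<Delta> s s = 0"
    unfolding s_def using assms by (intro RD_mult_single_self) auto
  ultimately have "RD_mult \<Delta> s (RD_mult \<Delta> s x) = 0"
    using RD_mult_assoc[OF assms(2), of s s x] by simp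
  moreover have x: "x = s + x' + RD_mult \<Delta> s x" by (simp add: x'_def)
  \<comment> \<open>Multiplying x = s + x' + s x by s on the left kills s s and s (s x), which
    leaves s x = s x'.\<close>
  ultimately have "RD_mult \<Delta> s x = RD_mult \<Delta> s x'"
    using ss RD_mult_add_right[of \<Delta> s "s + x'" "RD_mult \<Delta> s x"] by (simp add: RD_mult_add_right)
  with x have "(1, x) = (1, s) \<otimes>\<^bsub>GD \<Delta>\<^esub> (1, x')" unfolding GD_mult by simp
  with x' show thesis unfolding s_def by (rule that)
qed

lemma RD_in_closed_set:
  assumes "x \<in> RD \<Delta>"
  obtains S where "finite S" "S \<subseteq> \<Delta>" "products_in \<Delta> S S" "x \<in> RD S"
proof -
  have "finite (Poly_Mapping.keys x)" "Poly_Mapping.keys x \<subseteq> \<Delta>"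
    using assms by (auto simp: RD_def)
  then obtain S where "finite S" "Poly_Mapping.keys x \<subseteq> S" "S \<subseteq> \<Delta>" "products_in \<Delta> S S"
    by (rule finite_subset_closed_set)
  with that show thesis by (auto simp: RD_def)
qed

text \<open>The carrier is prescribed as all 1 + x, so invertibility needs proof. Splitting off 1 +
  a e_p leaves 1 + x' with smaller support; if v is a left inverse of 1 + x', then v (1 - a e_p) is
  one of 1 + x.\<close>

lemma group_GD:
  fixes \<Delta> :: "('i \<times> 'i) set"
  assumes "irrefl \<Delta>" "axiom_A2 \<Delta>"
  shows "group (GD \<Delta> :: ('r::ring_1 \<times> (('i \<times> 'i) \<Rightarrow>\<^sub>0 'r)) monoid)" (is "group ?G")
proof (rule groupI)
  have one: "(1, 0) \<in> carrier ?G" by (simp add: carrier_GD RD_def)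
  show "\<one>\<^bsub>?G\<^esub> \<in> carrier ?G" by (simp add: one one_GD)
  show l_one: "\<one>\<^bsub>?G\<^esub> \<otimes>\<^bsub>?G\<^esub> u = u" if "u \<in> carrier ?G" for u
    using that by (auto simp: carrier_GD one_GD GD_mult)
  have inv: "\<exists>v\<in>carrier ?G. v \<otimes>\<^bsub>?G\<^esub> (1, x) = \<one>\<^bsub>?G\<^esub>"
    if "finite S" "S \<subseteq> \<Delta>" "products_in \<Delta> S S" "x \<in> RD S" for S and x :: "('i \<times> 'i) \<Rightarrow>\<^sub>0 'r"
    using assms that(1-3) that(4)
  proof (induction S arbitrary: x rule: closed_set_induct)
    case empty
    then show ?case using one l_one[OF one] by (auto simp: RD_def one_GD)
  next
    case (remove S p)
    obtain a x' where x': "x' \<in> RD (S - {p})"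
      "(1, x) = (1, Poly_Mapping.single p a) \<otimes>\<^bsub>?G\<^esub> (1, x')"
      using GD_peel[OF assms remove.hyps remove.prems] .
    obtain v where v: "v \<in> carrier ?G" "v \<otimes>\<^bsub>?G\<^esub> (1, x') = \<one>\<^bsub>?G\<^esub>"
      using remove.IH[OF x'(1)] by blast
    have p: "p \<in> \<Delta>" using remove by blast
    let ?s = "\<lambda>a. (1, Poly_Mapping.single p a)"
    have car: "?s b \<in> carrier ?G" for b using p by (simp add: carrier_GD RD_single)
    have x'_car: "(1, x') \<in> carrier ?G"
      using x'(1) RD_mono[of "S - {p}" \<Delta>] remove.hyps by (auto simp: carrier_GD)
    have "?s (- a) \<otimes>\<^bsub>?G\<^esub> ?s a = \<one>\<^bsub>?G\<^esub>"
      using p assms by (simp add: GD_mult RD_mult_single_self one_GD flip: single_add)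
    then have "?s (- a) \<otimes>\<^bsub>?G\<^esub> (1, x) = (1, x')"
      unfolding x'(2) using GD_m_assoc[OF assms(2) car car x'_car] l_one[OF x'_car] by metis
    then have "v \<otimes>\<^bsub>?G\<^esub> ?s (- a) \<otimes>\<^bsub>?G\<^esub> (1, x) = \<one>\<^bsub>?G\<^esub>"
      using GD_m_assoc[OF assms(2) v(1) car, of "(1, x)" "- a"] v(2)
        GD_m_closed[OF car x'_car, of a] x'(2) by simp
    then show ?case using v(1) car GD_m_closed by blast
  qed
  show "\<exists>v\<in>carrier ?G. v \<otimes>\<^bsub>?G\<^esub> u = \<one>\<^bsub>?G\<^esub>" if u: "u \<in> carrier ?G" for u
  proof -
    obtain x where x: "u = (1, x)" "x \<in> RD \<Delta>" using u by (auto simp: carrier_GD)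
    obtain S where "finite S" "S \<subseteq> \<Delta>" "products_in \<Delta> S S" "x \<in> RD S"
      using RD_in_closed_set[OF x(2)] .
    then show ?thesis unfolding x(1) by (rule inv)
  qed
qed (use assms GD_m_assoc GD_m_closed in blast)+

lemma elementary_closed: "(i, j) \<in> \<Delta> \<Longrightarrow> elementary i j a \<in> carrier (GD \<Delta>)"
  by (simp add: elementary_def carrier_GD RD_single)

text \<open>Each removal of a position splits off one elementary factor on the left, until the empty
  support leaves the identity.\<close>

lemma elementary_generate_GD:
  fixes \<Delta> :: "('i \<times> 'i) set"
  assumes "irrefl \<Delta>" "axiom_A2 \<Delta>"
  shows "carrier (GD \<Delta>) \<subseteq> generate (GD \<Delta>) {elementary i j (a :: 'r::ring_1) | i j a. (i, j) \<in> \<Delta>}"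
    (is "_ \<subseteq> generate _ ?E")
proof
  have gen: "(1, x) \<in> generate (GD \<Delta>) ?E"
    if "finite S" "S \<subseteq> \<Delta>" "products_in \<Delta> S S" "x \<in> RD S" for S and x :: "('i \<times> 'i) \<Rightarrow>\<^sub>0 'r"
    using assms that(1-3) that(4)
  proof (induction S arbitrary: x rule: closed_set_induct)
    case empty
    then show ?case using generate.one[of "GD \<Delta>"] by (simp add: one_GD RD_def)
  next
    case (remove S p)
    obtain a x' where x': "x' \<in> RD (S - {p})"
      "(1, x) = (1, Poly_Mapping.single p a) \<otimes>\<^bsub>GD \<Delta>\<^esub> (1, x')"
      using GD_peel[OF assms remove.hyps remove.prems] .
    have "(1, Poly_Mapping.single p a) \<in> ?E"
      using remove.hyps unfolding elementary_def by (cases p) blast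
    then show ?case
      unfolding x'(2) using remove.IH[OF x'(1)] by (blast intro: generate.eng generate.incl)
  qed
  fix u :: "'r \<times> (('i \<times> 'i) \<Rightarrow>\<^sub>0 'r)" assume "u \<in> carrier (GD \<Delta>)"
  then obtain x where x: "u = (1, x)" "x \<in> RD \<Delta>" by (auto simp: carrier_GD)
  obtain S where "finite S" "S \<subseteq> \<Delta>" "products_in \<Delta> S S" "x \<in> RD S"
    using RD_in_closed_set[OF x(2)] .
  then show "u \<in> generate (GD \<Delta>) ?E" unfolding x(1) by (rule gen)
qed

text \<open>Clearing the inverses turns a commutator relation into an equation that can be checked
  by multiplying out.\<close>

lemma (in group) commutator_eq_iff:
  assumes "u \<in> carrier G" "v \<in> carrier G" "w \<in> carrier G"
  shows "commutator G u v = w \<longleftrightarrow> u \<otimes> v = w \<otimes> v \<otimes> u"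
proof -
  have "commutator G u v = u \<otimes> v \<otimes> inv (v \<otimes> u)"
    using assms by (simp add: commutator_def inv_mult_group m_assoc)
  then show ?thesis using assms inv_solve_right'[of w "u \<otimes> v" "v \<otimes> u"] by (auto simp: m_assoc)
qed

lemma elementary_commutators:
  assumes "irrefl \<Delta>" "axiom_A2 \<Delta>" and ij: "(i, j) \<in> \<Delta>"
  shows "(j, k) \<in> \<Delta> \<Longrightarrow> (i, k) \<in> \<Delta> \<Longrightarrow>
      commutator (GD \<Delta>) (elementary i j a) (elementary j k b) = elementary i k (a * b)"
    and "(j, k) \<in> \<Delta> \<Longrightarrow> (i, k) \<notin> \<Delta> \<Longrightarrow>
      commutator (GD \<Delta>) (elementary i j a) (elementary j k b) = \<one>\<^bsub>GD \<Delta>\<^esub>"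
    and "(k, l) \<in> \<Delta> \<Longrightarrow> j \<noteq> k \<Longrightarrow> i \<noteq> l \<Longrightarrow>
      commutator (GD \<Delta>) (elementary i j a) (elementary k l b) = \<one>\<^bsub>GD \<Delta>\<^esub>"
    and "elementary i j a \<otimes>\<^bsub>GD \<Delta>\<^esub> elementary i j b = elementary i j (a + b)"
proof -
  interpret group "GD \<Delta>" using assms(1,2) by (rule group_GD)
  note simps = commutator_eq_iff elementary_closed
  have irr: "(i, i) \<notin> \<Delta>" for i using assms(1) by (simp add: irrefl_def)
  show "commutator (GD \<Delta>) (elementary i j a) (elementary j k b) = elementary i k (a * b)"
    if "(j, k) \<in> \<Delta>" "(i, k) \<in> \<Delta>"
  proof -
    \<comment> \<open>With distinct indices, e_ij e_jk = e_ik is the one nonzero product among the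
      basis elements involved.\<close>
    have "i \<noteq> j" "j \<noteq> k" "i \<noteq> k" using that ij irr by auto
    with that ij show ?thesis
      by (simp add: simps)
        (simp add: elementary_def GD_mult RD_mult_add_left RD_mult_add_right RD_mult_single add_ac)
  qed
  \<comment> \<open>This includes k = i: then both products of the two basis elements would land on
    the diagonal, which \<open>\<Delta>\<close> avoids.\<close>
  show "commutator (GD \<Delta>) (elementary i j a) (elementary j k b) = \<one>\<^bsub>GD \<Delta>\<^esub>"
    if "(j, k) \<in> \<Delta>" "(i, k) \<notin> \<Delta>"
    using that ij irr
    by (simp add: simps) (simp add: elementary_def GD_mult RD_mult_single add_ac)
  show "commutator (GD \<Delta>) (elementary i j a) (elementary k l b) = \<one>\<^bsub>GD \<Delta>\<^esub>"
    if "(k, l) \<in> \<Delta>" "j \<noteq> k" "i \<noteq> l"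
    using that ij irr
    by (simp add: simps) (simp add: elementary_def GD_mult RD_mult_single add_ac)
  show "elementary i j a \<otimes>\<^bsub>GD \<Delta>\<^esub> elementary i j b = elementary i j (a + b)"
    using ij assms(1) by (simp add: elementary_def GD_mult RD_mult_single_self single_add)
qed

section \<open>Groups satisfying the defining relations\<close>

text \<open>The relations are assumed in an arbitrary group, so the rewriting to normal form uses
  equations in \<open>Q\<close> instead of cosets of words. The presented group is an
  instance.\<close>

locale steinberg_relations = group Q for Q (structure) +
  fixes \<Delta> :: "('i \<times> 'i) set" and x :: "'i \<Rightarrow> 'i \<Rightarrow> 'r::ring_1 \<Rightarrow> 'a"
  assumes irrefl: "irrefl \<Delta>" and A2: "axiom_A2 \<Delta>"
    and x_closed: "(i, j) \<in> \<Delta> \<Longrightarrow> x i j a \<in> carrier Q"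
    and x_product: "(i, j) \<in> \<Delta> \<Longrightarrow> (j, k) \<in> \<Delta> \<Longrightarrow> (i, k) \<in> \<Delta>
      \<Longrightarrow> commutator Q (x i j a) (x j k b) = x i k (a * b)"
    and x_no_product: "(i, j) \<in> \<Delta> \<Longrightarrow> (j, k) \<in> \<Delta> \<Longrightarrow> (i, k) \<notin> \<Delta>
      \<Longrightarrow> commutator Q (x i j a) (x j k b) = \<one>"
    and x_commute: "(i, j) \<in> \<Delta> \<Longrightarrow> (k, l) \<in> \<Delta> \<Longrightarrow> j \<noteq> k \<Longrightarrow> i \<noteq> l
      \<Longrightarrow> commutator Q (x i j a) (x k l b) = \<one>"
    and x_add: "(i, j) \<in> \<Delta> \<Longrightarrow> x i j a \<otimes> x i j b = x i j (a + b)"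
begin

definition gens :: "('i \<times> 'i) set \<Rightarrow> 'a set" where
  "gens S = generate Q {x i j a | i j a. (i, j) \<in> S}"

lemma gens_subgroup: "S \<subseteq> \<Delta> \<Longrightarrow> subgroup (gens S) Q"
  unfolding gens_def by (rule generate_is_subgroup) (auto intro: x_closed)

lemma gens_incl: "(i, j) \<in> S \<Longrightarrow> x i j a \<in> gens S"
  unfolding gens_def by (blast intro: generate.incl)

text \<open>By additivity this element is idempotent.\<close>

lemma x_zero: "(i, j) \<in> \<Delta> \<Longrightarrow> x i j 0 = \<one>"
  using x_add[of i j 0 0] x_closed[of i j 0] by simp

lemma x_inv: "(i, j) \<in> \<Delta> \<Longrightarrow> inv (x i j a) = x i j (- a)"
  using x_add[of i j "- a" a] x_closed x_zero by (intro inv_equality) auto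

lemma commutator_swap:
  "u \<in> carrier Q \<Longrightarrow> v \<in> carrier Q \<Longrightarrow> commutator Q u v = inv (commutator Q v u)"
  by (simp add: commutator_def inv_mult_group m_assoc)

text \<open>The relations settle j = k, and also the case where neither j = k nor i = l. If l = i,
  the commutator is the inverse of one with adjacent indices in the right order.\<close>

lemma commutator_in_gens:
  assumes "S \<subseteq> \<Delta>" "products_in \<Delta> S T" "T \<subseteq> \<Delta>" "(i, j) \<in> S" "(k, l) \<in> S"
  shows "commutator Q (x i j a) (x k l b) \<in> gens T"
proof -
  interpret T: subgroup "gens T" Q using assms by (intro gens_subgroup)
  have pr: "commutator Q (x i j a) (x j k b) \<in> gens T"
    if "(i, j) \<in> S" "(j, k) \<in> S" for i j k a b
    using that assms unfolding products_in_def
    by (cases "(i, k) \<in> \<Delta>") (auto simp: subset_iff x_product x_no_product gens_incl)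
  consider "j = k" | "l = i" | "j \<noteq> k" "i \<noteq> l" by blast
  then show ?thesis
  proof cases
    case 1
    then show ?thesis using assms pr by blast
  next
    case 2
    have "x i j a \<in> carrier Q" "x k l b \<in> carrier Q" using assms x_closed by blast+
    from commutator_swap[OF this] show ?thesis
      using 2 pr[of k i j b a] assms T.m_inv_closed by simp
  next
    case 3
    have "(i, j) \<in> \<Delta>" "(k, l) \<in> \<Delta>" using assms by blast+
    from x_commute[OF this 3] show ?thesis using T.one_closed by simp
  qed
qed

text \<open>Conjugating a generator h gives [x, h] h. By indecomposability of \<open>(i, j)\<close>
  the commutator stays in the subgroup of \<open>S - {(i, j)}\<close>, so \<open>x i j a\<close>
  conjugates this subgroup into itself.\<close>

lemma conj_gens:
  assumes "S \<subseteq> \<Delta>" "(i, j) \<in> S" "products_in \<Delta> S (S - {(i, j)})" "h \<in> gens (S - {(i, j)})"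
  shows "x i j a \<otimes> h \<otimes> inv (x i j a) \<in> gens (S - {(i, j)})"
proof -
  let ?T = "S - {(i, j)}"
  let ?c = "\<lambda>h. x i j a \<otimes> h \<otimes> inv (x i j a)"
  interpret T: subgroup "gens (?T)" Q using assms by (intro gens_subgroup) blast
  have xa: "x i j a \<in> carrier Q" using assms x_closed by blast
  have c_inv: "?c (inv h) = inv (?c h)" if "h \<in> carrier Q" for h
    using that xa by (simp add: inv_mult_group m_assoc)
  have gen: "?c h \<in> gens (?T)" if h': "h \<in> {x i j a | i j a. (i, j) \<in> ?T}" for h
  proof -
    obtain k l b where h: "h = x k l b" "(k, l) \<in> ?T" using h' by blast
    then have hc: "h \<in> carrier Q" using assms x_closed by blast
    have "?c h = commutator Q (x i j a) (x k l b) \<otimes> x k l b"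
      using hc xa by (simp add: commutator_def h(1) m_assoc)
    moreover have "commutator Q (x i j a) (x k l b) \<in> gens (?T)"
      using h assms by (intro commutator_in_gens[of S]) auto
    ultimately show ?thesis using h(2) gens_incl by simp
  qed
  have gc: "h \<in> carrier Q" if "h \<in> {x i j a | i j a. (i, j) \<in> ?T}" for h
    using that assms x_closed by blast
  show ?thesis
    using assms(4) unfolding gens_def[of "?T"]
  proof (induction rule: generate.induct)
    case one
    then show ?case using xa T.one_closed by (simp add: gens_def)
  next
    case (incl h)
    then show ?case using gen by (simp add: gens_def)
  next
    case (inv h)
    then show ?case using gen[OF inv] c_inv[OF gc[OF inv]] T.m_inv_closed by (simp add: gens_def)
  next
    case (eng h1 h2)
    then have "h1 \<in> carrier Q" "h2 \<in> carrier Q" using T.mem_carrier by (simp_all add: gens_def)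
    \<comment> \<open>Cancelling the inner factor makes conjugation multiplicative.\<close>
    moreover from this have "inv (x i j a) \<otimes> (x i j a \<otimes> (h2 \<otimes> inv (x i j a))) = h2 \<otimes> inv (x i j a)"
      using xa by (simp flip: m_assoc)
    ultimately have "?c (h1 \<otimes> h2) = ?c h1 \<otimes> ?c h2" using xa by (simp add: m_assoc)
    with eng show ?case by (simp add: generate.eng)
  qed
qed

text \<open>The products \<open>x i j a \<otimes> h'\<close> include all generators over
  \<open>S\<close> and their inverses. They are closed under multiplication because
  \<open>h'\<close> can be moved past \<open>x i j b\<close> by \<open>conj_gens\<close>, after
  which the two factors at \<open>(i, j)\<close> merge by additivity.\<close>

lemma gens_peel:
  assumes "S \<subseteq> \<Delta>" "(i, j) \<in> S" "products_in \<Delta> S (S - {(i, j)})" "h \<in> gens S"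
  shows "\<exists>a. \<exists>h'\<in>gens (S - {(i, j)}). h = x i j a \<otimes> h'"
proof -
  let ?T = "S - {(i, j)}"
  interpret T: subgroup "gens ?T" Q using assms by (intro gens_subgroup) blast
  have ij: "(i, j) \<in> \<Delta>" using assms by blast
  have gen: "\<exists>a. \<exists>h'\<in>gens ?T. x k l b = x i j a \<otimes> h'" if "(k, l) \<in> S" for k l b
  proof (cases "(k, l) = (i, j)")
    case True
    then show ?thesis using T.one_closed x_closed[OF ij] by (metis Pair_inject r_one)
  next
    case False
    then have "x k l b \<in> gens ?T" using that by (intro gens_incl) simp
    then show ?thesis using x_zero[OF ij] by (metis T.mem_carrier l_one)
  qed
  show ?thesis
    using assms(4) unfolding gens_def[of S]
  proof (induction rule: generate.induct)
    case one
    then show ?case using T.one_closed x_zero[OF ij] by (metis l_one one_closed)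
  next
    case (incl h)
    then show ?case using gen by blast
  next
    case (inv h)
    then obtain k l b where "h = x k l b" "(k, l) \<in> S" by blast
    moreover from this have "inv h = x k l (- b)" using x_inv assms(1) by blast
    ultimately show ?case using gen[of k l "- b"] by simp
  next
    case (eng h1 h2)
    then obtain a h b h' where
      h: "h \<in> gens ?T" "h1 = x i j a \<otimes> h" "h' \<in> gens ?T" "h2 = x i j b \<otimes> h'"
      by blast
    \<comment> \<open>Conjugation by the inverse of \<open>x i j b\<close>, so that
      \<open>h \<otimes> x i j b = x i j b \<otimes> c\<close>.\<close>
    define c where "c = x i j (- b) \<otimes> h \<otimes> inv (x i j (- b))"
    have c: "c \<in> gens ?T" unfolding c_def using assms h by (intro conj_gens)
    note car = x_closed[OF ij] T.mem_carrier[OF h(1)] T.mem_carrier[OF h(3)]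
    have "inv (x i j (- b)) = x i j b" using x_inv[OF ij, of "- b"] by simp
    then have "h \<otimes> x i j b = x i j b \<otimes> c"
      using car x_inv[OF ij, of b] by (simp add: c_def flip: m_assoc) (metis l_one r_inv)
    moreover have "h1 \<otimes> h2 = x i j a \<otimes> (h \<otimes> x i j b) \<otimes> h'"
      using car h by (simp add: m_assoc)
    ultimately have "h1 \<otimes> h2 = x i j a \<otimes> (x i j b \<otimes> c) \<otimes> h'" by simp
    also have "\<dots> = x i j (a + b) \<otimes> (c \<otimes> h')"
      using car T.mem_carrier[OF c] x_add[OF ij] by (simp flip: m_assoc)
    finally show ?case using T.m_closed[OF c h(3)] by blast
  qed
qed

text \<open>
  Writing \<open>h = x\<^bsub>p\<^esub>(a) h'\<close> with \<open>p\<close> indecomposable in \<open>S\<close>, the coefficient \<open>a\<close> is visible in the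
  image of \<open>h\<close>, since no product of elements of \<open>S\<close> contributes to position \<open>p\<close>.
\<close>

lemma hom_GD_trivial_kernel:
  assumes \<psi>: "\<psi> \<in> hom Q (GD \<Delta>)"
    and \<psi>_x: "\<And>i j a. (i, j) \<in> \<Delta> \<Longrightarrow> \<psi> (x i j a) = elementary i j a"
    and S: "finite S" "S \<subseteq> \<Delta>" "products_in \<Delta> S S"
    and h: "h \<in> gens S" "\<psi> h = \<one>\<^bsub>GD \<Delta>\<^esub>"
  shows "h = \<one>"
proof -
  \<comment> \<open>Products of positions in a closed \<open>S\<close> stay in \<open>S\<close>, so
    \<open>\<psi>\<close> sends \<open>gens S\<close> to elements 1 + y with \<open>y\<close>
    supported in \<open>S\<close>.\<close>
  have img: "\<psi> h \<in> Pair 1 ` RD S" if "S \<subseteq> \<Delta>" "products_in \<Delta> S S" "h \<in> gens S" for S h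
    using that(3) unfolding gens_def
  proof (induction rule: generate.induct)
    case one
    have "group_hom Q (GD \<Delta>) \<psi>"
      using \<psi> group_GD[OF irrefl A2] by (simp add: group_hom_def group_hom_axioms_def group_axioms)
    then show ?case using group_hom.hom_one by (fastforce simp: one_GD RD_def)
  next
    case (incl h)
    then show ?case using \<psi>_x that(1) by (auto simp: elementary_def RD_single)
  next
    case (inv h)
    then show ?case using \<psi>_x x_inv that(1) by (force simp: elementary_def RD_single)
  next
    case (eng h1 h2)
    then have "h1 \<in> carrier Q" "h2 \<in> carrier Q"
      using subgroup.mem_carrier[OF gens_subgroup[OF that(1)]] by (simp_all add: gens_def)
    then have "\<psi> (h1 \<otimes> h2) = \<psi> h1 \<otimes>\<^bsub>GD \<Delta>\<^esub> \<psi> h2" using \<psi> by (simp add: hom_mult)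
    with eng that show ?case by (auto simp: GD_mult intro!: RD_add RD_mult_in_RD)
  qed
  show ?thesis
    using irrefl A2 S h
  proof (induction S rule: closed_set_induct)
    case empty
    then show ?case by (simp add: gens_def generate_empty)
  next
    case (remove S p)
    obtain i j where p: "p = (i, j)" by (cases p)
    obtain a h' where h': "h' \<in> gens (S - {p})" "h = x i j a \<otimes> h'"
      using gens_peel[of S i j h] remove.hyps remove.prems unfolding p by blast
    have ij: "(i, j) \<in> \<Delta>" using remove.hyps p by blast
    have sub: "S - {p} \<subseteq> \<Delta>" "products_in \<Delta> (S - {p}) (S - {p})"
      using remove.hyps products_in_mono[OF remove.hyps(3)] by blast+
    have h'_car: "h' \<in> carrier Q"
      using h'(1) subgroup.mem_carrier[OF gens_subgroup[OF sub(1)]] by blast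
    obtain y where y: "\<psi> h' = (1, y)" "y \<in> RD (S - {p})" using img[OF sub h'(1)] by auto
    let ?s = "Poly_Mapping.single p a"
    have "\<psi> h = \<psi> (x i j a) \<otimes>\<^bsub>GD \<Delta>\<^esub> \<psi> h'"
      using \<psi> x_closed[OF ij] h'_car by (simp add: h'(2) hom_mult)
    also have "\<dots> = (1, ?s + y + RD_mult \<Delta> ?s y)"
      using \<psi>_x[OF ij] by (simp add: y(1) elementary_def p GD_mult)
    finally have "?s + y + RD_mult \<Delta> ?s y = 0" using remove.prems(2) by (simp add: one_GD)
    \<comment> \<open>Neither \<open>y\<close> nor its product with \<open>?s\<close> reaches
      \<open>p\<close>, so comparing coefficients at \<open>p\<close> isolates
      \<open>a\<close>.\<close>
    moreover have "RD_mult \<Delta> ?s y \<in> RD (S - {p})"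
      using remove.hyps y(2) RD_mono[of "S - {p}" S]
      by (intro RD_mult_in_RD[of _ S] RD_single) auto
    then have "Poly_Mapping.lookup (RD_mult \<Delta> ?s y) p = 0" "Poly_Mapping.lookup y p = 0"
      using y(2) by (auto simp: RD_def in_keys_iff)
    ultimately have "a = 0"
      by (metis add.right_neutral lookup_add lookup_single_eq lookup_zero)
    then have "h = h'" using h'(2) x_zero[OF ij] h'_car by simp
    with remove.IH h'(1) remove.prems(2) show ?case by simp
  qed
qed

end

section \<open>The presented group and its map onto G(\<Delta>)\<close>

lemma (in group_hom) hom_commutator:
  "u \<in> carrier G \<Longrightarrow> v \<in> carrier G \<Longrightarrow> h (commutator G u v) = commutator H (h u) (h v)"
  by (simp add: commutator_def)

lemma (in group) commutator_closed:
  "u \<in> carrier G \<Longrightarrow> v \<in> carrier G \<Longrightarrow> commutator G u v \<in> carrier G"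
  by (simp add: commutator_def)

lemma sym_gen_closed: "(i, j) \<in> \<Delta> \<Longrightarrow> sym_gen \<Delta> i j a \<in> carrier (free_group (symbols \<Delta>))"
  unfolding sym_gen_def by (rule free_gen_closed) (simp add: symbols_def)

lemma presentation_relations: "presentation (symbols \<Delta>) (relations \<Delta>)"
proof
  interpret F: group "free_group (symbols \<Delta>)" by (rule group_free_group)
  show "relations \<Delta> \<subseteq> carrier (free_group (symbols \<Delta>)) \<times> carrier (free_group (symbols \<Delta>))"
    unfolding relations_def Let_def
    by (intro Un_least subsetI; elim CollectE exE conjE)
      (simp_all add: sym_gen_closed F.commutator_closed)
qed

lemma relationsI:
  shows "(i, j) \<in> \<Delta> \<Longrightarrow> (j, k) \<in> \<Delta> \<Longrightarrow> (i, k) \<in> \<Delta> \<Longrightarrow>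
      (commutator (free_group (symbols \<Delta>)) (sym_gen \<Delta> i j a) (sym_gen \<Delta> j k b),
        sym_gen \<Delta> i k (a * b)) \<in> relations \<Delta>"
    and "(i, j) \<in> \<Delta> \<Longrightarrow> (j, k) \<in> \<Delta> \<Longrightarrow> (i, k) \<notin> \<Delta> \<Longrightarrow>
      (commutator (free_group (symbols \<Delta>)) (sym_gen \<Delta> i j a) (sym_gen \<Delta> j k b),
        \<one>\<^bsub>free_group (symbols \<Delta>)\<^esub>) \<in> relations \<Delta>"
    and "(i, j) \<in> \<Delta> \<Longrightarrow> (k, l) \<in> \<Delta> \<Longrightarrow> j \<noteq> k \<Longrightarrow> i \<noteq> l \<Longrightarrow>
      (commutator (free_group (symbols \<Delta>)) (sym_gen \<Delta> i j a) (sym_gen \<Delta> k l b),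
        \<one>\<^bsub>free_group (symbols \<Delta>)\<^esub>) \<in> relations \<Delta>"
    and "(i, j) \<in> \<Delta> \<Longrightarrow>
      (sym_gen \<Delta> i j a \<otimes>\<^bsub>free_group (symbols \<Delta>)\<^esub> sym_gen \<Delta> i j b, sym_gen \<Delta> i j (a + b))
        \<in> relations \<Delta>"
  unfolding relations_def Let_def Un_iff mem_Collect_eq prod.inject by metis+

text \<open>The projection from the free group is a homomorphism identifying the two sides of every
  relation, so each relation passes to the images of the symbols.\<close>

lemma steinberg_relations_presented_group:
  fixes \<Delta> :: "('i \<times> 'i) set"
  assumes "irrefl \<Delta>" "axiom_A2 \<Delta>"
  shows "steinberg_relations (presented_group (symbols \<Delta>) (relations \<Delta>)) \<Delta>
    (\<lambda>i j (a :: 'r::ring_1). presented_gen (symbols \<Delta>) (relations \<Delta>) ((i, j), a))"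
proof -
  let ?X = "symbols \<Delta> :: (('i \<times> 'i) \<times> 'r) set" and ?R = "relations \<Delta> :: (((('i \<times> 'i) \<times> 'r) \<times> bool) list set \<times> _) set"
  interpret presentation ?X ?R by (rule presentation_relations)
  let ?\<pi> = "\<lambda>u. relator_closure ?X ?R #>\<^bsub>free_group ?X\<^esub> u"
  have gen: "presented_gen ?X ?R ((i, j), a) = ?\<pi> (sym_gen \<Delta> i j a)" for i j a
    by (simp add: presented_gen_def sym_gen_def)
  have comm: "commutator (presented_group ?X ?R) (?\<pi> (sym_gen \<Delta> i j a)) (?\<pi> (sym_gen \<Delta> k l b))
      = ?\<pi> (commutator (free_group ?X) (sym_gen \<Delta> i j a) (sym_gen \<Delta> k l b))"
    if "(i, j) \<in> \<Delta>" "(k, l) \<in> \<Delta>" for i j k l a b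
    using that by (simp add: proj.hom_commutator sym_gen_closed)
  show ?thesis
  proof (unfold steinberg_relations_def steinberg_relations_axioms_def gen, intro conjI allI impI)
    show "?\<pi> (sym_gen \<Delta> i j a) \<in> carrier (presented_group ?X ?R)" if "(i, j) \<in> \<Delta>" for i j a
      using that by (simp add: sym_gen_closed)
    show "commutator (presented_group ?X ?R) (?\<pi> (sym_gen \<Delta> i j a)) (?\<pi> (sym_gen \<Delta> j k b))
        = ?\<pi> (sym_gen \<Delta> i k (a * b))"
      if "(i, j) \<in> \<Delta>" "(j, k) \<in> \<Delta>" "(i, k) \<in> \<Delta>" for i j k a b
      unfolding comm[OF that(1,2)] using that by (intro relation_holds relationsI)
    show "commutator (presented_group ?X ?R) (?\<pi> (sym_gen \<Delta> i j a)) (?\<pi> (sym_gen \<Delta> j k b))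
        = \<one>\<^bsub>presented_group ?X ?R\<^esub>"
      if "(i, j) \<in> \<Delta>" "(j, k) \<in> \<Delta>" "(i, k) \<notin> \<Delta>" for i j k a b
      \<comment> \<open>The identity is rewritten as the coset of the identity of the free group,
        the form in which the relation is listed.\<close>
      unfolding comm[OF that(1,2)] proj.hom_one[symmetric]
      using that by (intro relation_holds relationsI)
    show "commutator (presented_group ?X ?R) (?\<pi> (sym_gen \<Delta> i j a)) (?\<pi> (sym_gen \<Delta> k l b))
        = \<one>\<^bsub>presented_group ?X ?R\<^esub>"
      if "(i, j) \<in> \<Delta>" "(k, l) \<in> \<Delta>" "j \<noteq> k" "i \<noteq> l" for i j k l a b
      unfolding comm[OF that(1,2)] proj.hom_one[symmetric]
      using that by (intro relation_holds relationsI)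
    show "?\<pi> (sym_gen \<Delta> i j a) \<otimes>\<^bsub>presented_group ?X ?R\<^esub> ?\<pi> (sym_gen \<Delta> i j b)
        = ?\<pi> (sym_gen \<Delta> i j (a + b))" if "(i, j) \<in> \<Delta>" for i j a b
      unfolding proj.hom_mult[OF sym_gen_closed[OF that] sym_gen_closed[OF that], symmetric]
      using that by (intro relation_holds relationsI)
  qed (use assms P.group_axioms in auto)
qed

theorem theorem4p4:
  fixes \<Lambda> :: "'i set" and \<Delta> :: "('i \<times> 'i) set"
  assumes "\<Delta> \<subseteq> \<Lambda> \<times> \<Lambda>" and "axiom_A1 \<Lambda> \<Delta>" and "axiom_A2 \<Delta>"
  shows "is_presentation (GD \<Delta>) (symbols \<Delta>)
           (\<lambda>((i, j), a :: 'r::ring_1). elementary i j a) (relations \<Delta>)"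
proof -
  let ?X = "symbols \<Delta> :: (('i \<times> 'i) \<times> 'r) set"
  let ?R = "relations \<Delta> :: (((('i \<times> 'i) \<times> 'r) \<times> bool) list set \<times> _) set"
  let ?f = "\<lambda>((i, j), a :: 'r). elementary i j a"
  \<comment> \<open>(A1) speaks about indices in \<open>\<Lambda>\<close>; the inclusion of
    \<open>\<Delta>\<close> in \<open>\<Lambda> \<times> \<Lambda>\<close> extends it to all
    diagonal pairs of the type.\<close>
  have irr: "irrefl \<Delta>" using assms(1,2) by (auto simp: irrefl_def axiom_A1_def)
  note A2 = assms(3)
  interpret presentation ?X ?R by (rule presentation_relations)
  interpret Q: steinberg_relations "presented_group ?X ?R" \<Delta> "\<lambda>i j a. presented_gen ?X ?R ((i, j), a)"
    using irr A2 by (rule steinberg_relations_presented_group)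
  interpret G: group "GD \<Delta> :: ('r \<times> (('i \<times> 'i) \<Rightarrow>\<^sub>0 'r)) monoid" using irr A2 by (rule group_GD)
  show ?thesis
  proof (rule is_presentationI)
    show f: "?f \<in> ?X \<rightarrow> carrier (GD \<Delta>)" by (auto simp: symbols_def elementary_closed)
    show "carrier (GD \<Delta>) \<subseteq> generate (GD \<Delta>) (?f ` ?X)"
    proof -
      have "{elementary i j a | i j (a :: 'r). (i, j) \<in> \<Delta>} = ?f ` ?X"
        by (force simp: symbols_def)
      from elementary_generate_GD[OF irr A2, where 'r = 'r, unfolded this] show ?thesis .
    qed
    show "free_lift (GD \<Delta>) ?f u = free_lift (GD \<Delta>) ?f v" if "(u, v) \<in> ?R" for u v
    proof -
      interpret lift: group_hom "free_group ?X" "GD \<Delta>" "free_lift (GD \<Delta>) ?f"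
        unfolding group_hom_def group_hom_axioms_def
        using F.group_axioms G.group_axioms G.free_lift_hom[OF f] by simp
      have gen: "free_lift (GD \<Delta>) ?f (sym_gen \<Delta> i j a) = elementary i j a" if "(i, j) \<in> \<Delta>" for i j a
        using that G.free_lift_gen[OF f, of "((i, j), a)"] by (simp add: sym_gen_def symbols_def)
      from that consider
          (product) i j k a b where "(i, j) \<in> \<Delta>" "(j, k) \<in> \<Delta>" "(i, k) \<in> \<Delta>"
            "u = commutator (free_group ?X) (sym_gen \<Delta> i j a) (sym_gen \<Delta> j k b)"
            "v = sym_gen \<Delta> i k (a * b)"
        | (no_product) i j k a b where "(i, j) \<in> \<Delta>" "(j, k) \<in> \<Delta>" "(i, k) \<notin> \<Delta>"
            "u = commutator (free_group ?X) (sym_gen \<Delta> i j a) (sym_gen \<Delta> j k b)"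
            "v = \<one>\<^bsub>free_group ?X\<^esub>"
        | (commute) i j k l a b where "(i, j) \<in> \<Delta>" "(k, l) \<in> \<Delta>" "j \<noteq> k" "i \<noteq> l"
            "u = commutator (free_group ?X) (sym_gen \<Delta> i j a) (sym_gen \<Delta> k l b)"
            "v = \<one>\<^bsub>free_group ?X\<^esub>"
        | (add) i j a b where "(i, j) \<in> \<Delta>"
            "u = sym_gen \<Delta> i j a \<otimes>\<^bsub>free_group ?X\<^esub> sym_gen \<Delta> i j b" "v = sym_gen \<Delta> i j (a + b)"
        unfolding relations_def Let_def by blast
      then show ?thesis
        by cases (simp_all add: lift.hom_commutator gen sym_gen_closed elementary_commutators[OF irr A2])
    qed
    fix \<psi> Y q
    assume Y: "finite Y" "Y \<subseteq> ?X" and \<psi>: "\<psi> \<in> hom (presented_group ?X ?R) (GD \<Delta>)"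
      "\<And>s. s \<in> ?X \<Longrightarrow> \<psi> (presented_gen ?X ?R s) = ?f s"
      and q: "q \<in> generate (presented_group ?X ?R) (presented_gen ?X ?R ` Y)" "\<psi> q = \<one>\<^bsub>GD \<Delta>\<^esub>"
    \<comment> \<open>The coefficients occurring in \<open>Y\<close> are forgotten: finitely many
      positions suffice, and \<open>gens S\<close> allows every coefficient at each of them.\<close>
    have "finite (fst ` Y)" "fst ` Y \<subseteq> \<Delta>" using Y by (auto simp: symbols_def)
    then obtain S where S: "finite S" "fst ` Y \<subseteq> S" "S \<subseteq> \<Delta>" "products_in \<Delta> S S"
      by (rule finite_subset_closed_set)
    have "presented_gen ?X ?R ` Y \<subseteq> {presented_gen ?X ?R ((i, j), a) | i j a. (i, j) \<in> S}"
      using S(2) by force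
    then have "q \<in> Q.gens S"
      unfolding Q.gens_def using P.mono_generate q(1) by blast
    then show "q = \<one>\<^bsub>presented_group ?X ?R\<^esub>"
      using \<psi> q(2) S by (intro Q.hom_GD_trivial_kernel[of \<psi> S]) (auto simp: symbols_def)
  qed (rule G.group_axioms)
qed

end
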